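(* The assignments $\mathrm{Det}:\mathsf{aut}_{\mathsf{Dep}}\to\mathsf{dfa}_{\mathsf{JSL}}$ and $\mathrm{Airr}:\mathsf{dfa}_{\mathsf{JSL}}\to\mathsf{aut}_{\mathsf{Dep}}$ defined in the context are functors and define an equivalence of categories, with natural isomorphisms $$\mathrm{rep}:\mathrm{Id}_{\mathsf{dfa}_{\mathsf{JSL}}}\Rightarrow\mathrm{Det}\circ\mathrm{Airr},\qquad \mathrm{rep}_{(s,\mathbb S,\delta_a,F)}:=\lambda x\in S.\ \{m\in M(\mathbb S): x\nleq_{\mathbb S} m\},$$ $$\mathrm{red}:\mathrm{Id}_{\mathsf{aut}_{\mathsf{Dep}}}\Rightarrow\mathrm{Airr}\circ\mathrm{Det},\qquad \mathrm{red}_{(\mathcal N,\mathcal G,\mathcal N')}:=\{(g,Y)\in\mathcal G_s\times M(\mathrm{Open}\,\mathcal G):\mathcal G[g]\nsubseteq Y\}.$$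
   Context: Fix an alphabet $\Sigma$; $a$ ranges over $\Sigma$. Relations. For $\mathcal R\subseteq X\times Y$ write $\mathcal R_s=X$, $\mathcal R_t=Y$, $\mathcal R[A]=\{y:\exists x\in A.\,\mathcal R(x,y)\}$, $\mathcal R[x]=\mathcal R[\{x\}]$, $\breve{\mathcal R}$ for the converse, and $\mathcal R;\mathcal S(x,z)\iff\exists y.\,\mathcal R(x,y)\wedge\mathcal S(y,z)$. Complements are written $\overline{X}$. Category $\mathsf{Dep}$. Objects: relations $\mathcal G\subseteq\mathcal G_s\times\mathcal G_t$ between finite sets. A morphism $\mathcal R:\mathcal G\to\mathcal H$ is a relation $\mathcal R\subseteq\mathcal G_s\times\mathcal H_t$ for which there are $\mathcal R_l\subseteq\mathcal G_s\times\mathcal H_s$ and $\mathcal R_u\subseteq\mathcal H_t\times\mathcal G_t$ with $\mathcal R_l;\mathcal H=\mathcal R=\mathcal G;\breve{\mathcal R_u}$. The largest such witnesses are $\mathcal R_-=\{(g,h)\in\mathcal G_s\times\mathcal H_s:\mathcal H[h]\subseteq\mathcal R[g]\}$ and $\mathcal R_+=\{(h,g)\in\mathcal H_t\times\mathcal G_t:\breve{\mathcal G}[g]\subseteq\breve{\mathcal R}[h]\}$. Identity: $\mathrm{id}_{\mathcal G}=\mathcal G$. The composite in $\mathsf{Dep}$ of $\mathcal R:\mathcal G\to\mathcal H$ followed by $\mathcal S:\mathcal H\to\mathcal I$ is the relation $\mathcal R_-;\mathcal S=\mathcal R;\breve{(\mathcal S_+)}$ (independent of the choice of witnesses). Nfas.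 An nfa is $\mathcal N=(I_{\mathcal N},Z,\mathcal N_a,F_{\mathcal N})$ with $Z$ a finite set of states, $I_{\mathcal N},F_{\mathcal N}\subseteq Z$ initial/final states, $\mathcal N_a\subseteq Z\times Z$. Category $\mathsf{aut}_{\mathsf{Dep}}$. Objects (dependency automata): triples $(\mathcal N,\mathcal G,\mathcal N')$ with $\mathcal G\subseteq\mathcal G_s\times\mathcal G_t$ a relation between finite sets, $\mathcal N$ an nfa with states $\mathcal G_s$, $\mathcal N'$ an nfa with states $\mathcal G_t$, such that $\mathcal N_a;\mathcal G=\mathcal G;\breve{(\mathcal N'_a)}$ for all $a$, $F_{\mathcal N'}=\mathcal G[I_{\mathcal N}]$ and $F_{\mathcal N}=\breve{\mathcal G}[I_{\mathcal N'}]$. A morphism $\mathcal R:(\mathcal M,\mathcal F,\mathcal M')\to(\mathcal N,\mathcal G,\mathcal N')$ is a $\mathsf{Dep}$-morphism $\mathcal R:\mathcal F\to\mathcal G$ with $\mathcal M_a;\mathcal R=\mathcal R;\breve{(\mathcal N'_a)}$ for all $a$, $\mathcal R[I_{\mathcal M}]=F_{\mathcal N'}$ and $\breve{\mathcal R}[I_{\mathcal N'}]=F_{\mathcal M}$. Identities and composition are those of $\mathsf{Dep}$. Category $\mathsf{dfa}_{\mathsf{JSL}}$. A (finite) join-semilattice $\mathbb S=(S,\vee_{\mathbb S},\bot_{\mathbb S})$ has all finite joins (including bottom); morphisms preserve all finite joins. $J(\mathbb S)$ and $M(\mathbb S)$ denote its join-irreducible and meet-irreducible elements (bottom is not join-irreducible,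 top is not meet-irreducible). The adjoint of $f:\mathbb S\to\mathbb T$ is $f_*(t)=\bigvee_{\mathbb S}\{s:f(s)\leq_{\mathbb T}t\}$. A $\mathsf{JSL}$-dfa is $(s_0,\mathbb S,\delta_a,F)$ with $\mathbb S$ a finite join-semilattice, $s_0\in S$, $\delta_a:\mathbb S\to\mathbb S$ join-semilattice morphisms, and $F=\{s:s\nleq_{\mathbb S}t\}$ for some $t\in S$. A morphism $f:(s_0,\mathbb S,\gamma_a,F)\to(t_0,\mathbb T,\delta_a,F')$ is a join-semilattice morphism with $f(s_0)=t_0$, $f\circ\gamma_a=\delta_a\circ f$, $f^{-1}(F')=F$; composition is functional. Functors on underlying structures. $\mathrm{Open}\,\mathcal G=(O(\mathcal G),\cup,\emptyset)$ with $O(\mathcal G)=\{\mathcal G[X]:X\subseteq\mathcal G_s\}$, and $\mathrm{Open}\,\mathcal R=\lambda Y.\,\breve{(\mathcal R_+)}[Y]$. $\mathrm{Pirr}\,\mathbb S=\{(j,m)\in J(\mathbb S)\times M(\mathbb S):j\nleq_{\mathbb S}m\}$; for $f:\mathbb S\to\mathbb T$, $\mathrm{Pirr}f\subseteq J(\mathbb S)\times M(\mathbb T)$ is $\mathrm{Pirr}f(j,m)\iff f(j)\nleq_{\mathbb T}m$, and its maximal witnesses are $(\mathrm{Pirr}f)_-(j_1,j_2)\iff j_2\leq_{\mathbb T}f(j_1)$ and $(\mathrm{Pirr}f)_+(m_1,m_2)\iff f_*(m_1)\leq_{\mathbb S}m_2$. $\mathrm{Det}$ and $\mathrm{Airr}$.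 $\mathrm{Det}(\mathcal N,\mathcal G,\mathcal N'):=(F_{\mathcal N'},\mathrm{Open}\,\mathcal G,\lambda Y.\,\breve{(\mathcal N'_a)}[Y],\{Y\in O(\mathcal G):Y\cap I_{\mathcal N'}\neq\emptyset\})$, acting on morphisms as $\mathrm{Open}$. $\mathrm{Airr}(s_0,\mathbb S,\delta_a,F):=(\mathcal N,\mathrm{Pirr}\,\mathbb S,\mathcal N')$ with $\mathcal N=(\{j\in J(\mathbb S):j\leq s_0\},J(\mathbb S),(\mathrm{Pirr}\,\delta_a)_-,J(\mathbb S)\cap F)$ and $\mathcal N'=(\{m\in M(\mathbb S):\bigvee_{\mathbb S}\overline F\leq m\},M(\mathbb S),(\mathrm{Pirr}\,\delta_a)_+,\{m\in M(\mathbb S):s_0\nleq m\})$, acting on morphisms as $\mathrm{Pirr}$. *)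

theory Defs
  imports "HOL-Algebra.Lattice" "HOL-Library.FSet"
begin

text \<open>
  Categories are given by indexed hom-sets. Two hom-sets may share elements, so identities,
  composition and the action of a functor on morphisms take the objects as arguments.
  \<open>Comp C A B D f g\<close> is the composite of \<open>f : A \<rightarrow> B\<close> followed by \<open>g : B \<rightarrow> D\<close>.
\<close>

record ('o, 'm) category =
  Obj :: "'o set"
  Hom :: "'o \<Rightarrow> 'o \<Rightarrow> 'm set"
  Ident :: "'o \<Rightarrow> 'm"
  Comp :: "'o \<Rightarrow> 'o \<Rightarrow> 'o \<Rightarrow> 'm \<Rightarrow> 'm \<Rightarrow> 'm"

locale category =
  fixes C :: "('o, 'm) category"
  assumes Ident_in_Hom: "A \<in> Obj C \<Longrightarrow> Ident C A \<in> Hom C A A"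
    and Comp_in_Hom: "\<lbrakk>A \<in> Obj C; B \<in> Obj C; D \<in> Obj C; f \<in> Hom C A B; g \<in> Hom C B D\<rbrakk>
      \<Longrightarrow> Comp C A B D f g \<in> Hom C A D"
    and Ident_left: "\<lbrakk>A \<in> Obj C; B \<in> Obj C; f \<in> Hom C A B\<rbrakk>
      \<Longrightarrow> Comp C A A B (Ident C A) f = f"
    and Ident_right: "\<lbrakk>A \<in> Obj C; B \<in> Obj C; f \<in> Hom C A B\<rbrakk>
      \<Longrightarrow> Comp C A B B f (Ident C B) = f"
    and Comp_assoc: "\<lbrakk>A \<in> Obj C; B \<in> Obj C; D \<in> Obj C; E \<in> Obj C;
        f \<in> Hom C A B; g \<in> Hom C B D; h \<in> Hom C D E\<rbrakk>
      \<Longrightarrow> Comp C A D E (Comp C A B D f g) h = Comp C A B E f (Comp C B D E g h)"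

definition is_iso :: "('o, 'm) category \<Rightarrow> 'o \<Rightarrow> 'o \<Rightarrow> 'm \<Rightarrow> bool" where
  "is_iso C A B f \<longleftrightarrow> f \<in> Hom C A B \<and>
     (\<exists>g \<in> Hom C B A. Comp C A B A f g = Ident C A \<and> Comp C B A B g f = Ident C B)"

record ('o1, 'm1, 'o2, 'm2) funct =
  on_obj :: "'o1 \<Rightarrow> 'o2"
  on_hom :: "'o1 \<Rightarrow> 'o1 \<Rightarrow> 'm1 \<Rightarrow> 'm2"

locale is_functor = C: category C + D: category D
  for C :: "('o1, 'm1) category" and D :: "('o2, 'm2) category" +
  fixes F :: "('o1, 'm1, 'o2, 'm2) funct"
  assumes on_obj_in_Obj: "A \<in> Obj C \<Longrightarrow> on_obj F A \<in> Obj D"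
    and on_hom_in_Hom: "\<lbrakk>A \<in> Obj C; B \<in> Obj C; f \<in> Hom C A B\<rbrakk>
      \<Longrightarrow> on_hom F A B f \<in> Hom D (on_obj F A) (on_obj F B)"
    and on_hom_Ident: "A \<in> Obj C \<Longrightarrow> on_hom F A A (Ident C A) = Ident D (on_obj F A)"
    and on_hom_Comp: "\<lbrakk>A \<in> Obj C; B \<in> Obj C; E \<in> Obj C; f \<in> Hom C A B; g \<in> Hom C B E\<rbrakk>
      \<Longrightarrow> on_hom F A E (Comp C A B E f g) =
          Comp D (on_obj F A) (on_obj F B) (on_obj F E) (on_hom F A B f) (on_hom F B E g)"

definition id_functor :: "('o, 'm, 'o, 'm) funct" where
  "id_functor = \<lparr>on_obj = (\<lambda>A. A), on_hom = (\<lambda>A B f. f)\<rparr>"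

definition comp_functor ::
  "('o2, 'm2, 'o3, 'm3) funct \<Rightarrow> ('o1, 'm1, 'o2, 'm2) funct \<Rightarrow> ('o1, 'm1, 'o3, 'm3) funct"
  (infixl \<open>\<circ>\<^sub>F\<close> 55) where
  "G \<circ>\<^sub>F F = \<lparr>on_obj = (\<lambda>A. on_obj G (on_obj F A)),
     on_hom = (\<lambda>A B f. on_hom G (on_obj F A) (on_obj F B) (on_hom F A B f))\<rparr>"

locale natural_isomorphism = F: is_functor C D F + G: is_functor C D G
  for C :: "('o1, 'm1) category" and D :: "('o2, 'm2) category"
    and F G :: "('o1, 'm1, 'o2, 'm2) funct" +
  fixes \<eta> :: "'o1 \<Rightarrow> 'm2"
  assumes natural: "\<lbrakk>A \<in> Obj C; B \<in> Obj C; f \<in> Hom C A B\<rbrakk>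
      \<Longrightarrow> Comp D (on_obj F A) (on_obj F B) (on_obj G B) (on_hom F A B f) (\<eta> B) =
          Comp D (on_obj F A) (on_obj G A) (on_obj G B) (\<eta> A) (on_hom G A B f)"
    and component_iso: "A \<in> Obj C \<Longrightarrow> is_iso D (on_obj F A) (on_obj G A) (\<eta> A)"

locale equivalence_of_categories =
  F: is_functor C D F + G: is_functor D C G +
  unit: natural_isomorphism C C id_functor "G \<circ>\<^sub>F F" \<eta> +
  counit: natural_isomorphism D D id_functor "F \<circ>\<^sub>F G" \<epsilon>
  for C :: "('o1, 'm1) category" and D :: "('o2, 'm2) category"
    and F :: "('o1, 'm1, 'o2, 'm2) funct" and G :: "('o2, 'm2, 'o1, 'm1) funct"
    and \<eta> :: "'o1 \<Rightarrow> 'm1" and \<epsilon> :: "'o2 \<Rightarrow> 'm2"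

text \<open>
  The functors below turn finite sets into sets of finite sets, so the categories need a universe
  in which the finite subsets are again elements: the hereditarily finite sets over urelements of
  an arbitrary type \<open>'x\<close>. The underlying finite sets of all objects are finite subsets of it.
\<close>

datatype 'x hf = Urelement 'x | HF_Set "'x hf fset"

definition hf_set :: "'x hf set \<Rightarrow> 'x hf" where
  "hf_set A = HF_Set (Abs_fset A)"  \<comment> \<open>meaningful for finite \<open>A\<close> only\<close>

fun elts :: "'x hf \<Rightarrow> 'x hf set" where
  "elts (Urelement x) = {}"
| "elts (HF_Set A) = fset A"

record 'u dep =
  src :: "'u set"
  tgt :: "'u set"
  rel :: "'u rel"

definition dep_obj :: "'u dep \<Rightarrow> bool" where
  "dep_obj G \<longleftrightarrow> finite (src G) \<and> finite (tgt G) \<and> rel G \<subseteq> src G \<times> tgt G"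

definition dep_hom :: "'u dep \<Rightarrow> 'u dep \<Rightarrow> 'u rel set" where
  "dep_hom G H = {R. R \<subseteq> src G \<times> tgt H \<and>
     (\<exists>Rl Ru. Rl \<subseteq> src G \<times> src H \<and> Ru \<subseteq> tgt H \<times> tgt G \<and>
        Rl O rel H = R \<and> R = rel G O Ru\<inverse>)}"

definition dep_minus :: "'u dep \<Rightarrow> 'u dep \<Rightarrow> 'u rel \<Rightarrow> 'u rel" where
  "dep_minus G H R = {(g, h). g \<in> src G \<and> h \<in> src H \<and> rel H `` {h} \<subseteq> R `` {g}}"

definition dep_plus :: "'u dep \<Rightarrow> 'u dep \<Rightarrow> 'u rel \<Rightarrow> 'u rel" where
  "dep_plus G H R = {(h, g). h \<in> tgt H \<and> g \<in> tgt G \<and> (rel G)\<inverse> `` {g} \<subseteq> R\<inverse> `` {h}}"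

text \<open>
  \<open>dep_minus G H R\<close> and \<open>dep_plus G H R\<close> are the largest witnesses for \<open>R : G \<rightarrow> H\<close>. They depend on
  \<open>G\<close> and \<open>H\<close>, hence so does composition (in diagrammatic order).
\<close>

definition dep_comp :: "'u dep \<Rightarrow> 'u dep \<Rightarrow> 'u rel \<Rightarrow> 'u rel \<Rightarrow> 'u rel" where
  "dep_comp G H R S = dep_minus G H R O S"

record ('a, 'u) nfa =
  states :: "'u set"
  init :: "'u set"
  step :: "'a \<Rightarrow> 'u rel"
  final :: "'u set"

definition nfa :: "('a, 'u) nfa \<Rightarrow> bool" where
  "nfa N \<longleftrightarrow> finite (states N) \<and> init N \<subseteq> states N \<and> final N \<subseteq> states N \<and>
     (\<forall>a. step N a \<subseteq> states N \<times> states N)"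

record ('a, 'u) dep_aut =
  lower :: "('a, 'u) nfa"
  base :: "'u dep"
  upper :: "('a, 'u) nfa"

definition dep_aut :: "('a, 'u) dep_aut \<Rightarrow> bool" where
  "dep_aut A \<longleftrightarrow> (let N = lower A; G = base A; N' = upper A in
     dep_obj G \<and> nfa N \<and> nfa N' \<and> states N = src G \<and> states N' = tgt G \<and>
     (\<forall>a. step N a O rel G = rel G O (step N' a)\<inverse>) \<and>
     final N' = rel G `` init N \<and> final N = (rel G)\<inverse> `` init N')"

definition dep_aut_hom :: "('a, 'u) dep_aut \<Rightarrow> ('a, 'u) dep_aut \<Rightarrow> 'u rel set" where
  "dep_aut_hom A B = {R \<in> dep_hom (base A) (base B).
     (\<forall>a. step (lower A) a O R = R O (step (upper B) a)\<inverse>) \<and>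
     R `` init (lower A) = final (upper B) \<and>
     R\<inverse> `` init (upper B) = final (lower A)}"

definition aut_Dep :: "(('a, 'u) dep_aut, 'u rel) category" where
  "aut_Dep = \<lparr>Obj = {A. dep_aut A}, Hom = dep_aut_hom, Ident = (\<lambda>A. rel (base A)),
     Comp = (\<lambda>A B D R S. dep_comp (base A) (base B) R S)\<rparr>"

text \<open>
  The order is required to relate only elements of the
  carrier, and functions between carriers (transitions and morphisms) are extensional, so that
  objects and morphisms are determined by their mathematical data.
\<close>

locale finite_jsl = upper_semilattice L + weak_partial_order_bottom L
  for L :: "'u gorder" (structure) +
  assumes finite_carrier: "finite (carrier L)"
    and le_in_carrier: "x \<sqsubseteq> y \<Longrightarrow> x \<in> carrier L \<and> y \<in> carrier L"

text \<open>All joins in a finite semilattice are finite; \<open>A = {}\<close> gives preservation of bottom.\<close>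

definition jsl_hom :: "'u gorder \<Rightarrow> 'u gorder \<Rightarrow> ('u \<Rightarrow> 'u) set" where
  "jsl_hom S T = {f \<in> carrier S \<rightarrow>\<^sub>E carrier T.
     \<forall>A \<subseteq> carrier S. f (\<Squnion>\<^bsub>S\<^esub> A) = \<Squnion>\<^bsub>T\<^esub> (f ` A)}"

definition join_irr :: "'u gorder \<Rightarrow> 'u set" where
  "join_irr S = {j \<in> carrier S. j \<noteq> \<bottom>\<^bsub>S\<^esub> \<and>
     (\<forall>x \<in> carrier S. \<forall>y \<in> carrier S. j = x \<squnion>\<^bsub>S\<^esub> y \<longrightarrow> j = x \<or> j = y)}"

definition meet_irr :: "'u gorder \<Rightarrow> 'u set" where
  "meet_irr S = {m \<in> carrier S. m \<noteq> \<top>\<^bsub>S\<^esub> \<and>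
     (\<forall>x \<in> carrier S. \<forall>y \<in> carrier S. m = x \<sqinter>\<^bsub>S\<^esub> y \<longrightarrow> m = x \<or> m = y)}"

record ('a, 'u) jsl_dfa =
  start :: "'u"
  jsl :: "'u gorder"
  delta :: "'a \<Rightarrow> 'u \<Rightarrow> 'u"
  accept :: "'u set"

definition jsl_dfa :: "('a, 'u) jsl_dfa \<Rightarrow> bool" where
  "jsl_dfa A \<longleftrightarrow> finite_jsl (jsl A) \<and> start A \<in> carrier (jsl A) \<and>
     (\<forall>a. delta A a \<in> jsl_hom (jsl A) (jsl A)) \<and>
     (\<exists>t \<in> carrier (jsl A). accept A = {s \<in> carrier (jsl A). \<not> s \<sqsubseteq>\<^bsub>jsl A\<^esub> t})"

definition jsl_dfa_hom :: "('a, 'u) jsl_dfa \<Rightarrow> ('a, 'u) jsl_dfa \<Rightarrow> ('u \<Rightarrow> 'u) set" where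
  "jsl_dfa_hom A B = {f \<in> jsl_hom (jsl A) (jsl B).
     f (start A) = start B \<and>
     (\<forall>a. \<forall>s \<in> carrier (jsl A). f (delta A a s) = delta B a (f s)) \<and>
     {s \<in> carrier (jsl A). f s \<in> accept B} = accept A}"

definition dfa_JSL :: "(('a, 'u) jsl_dfa, 'u \<Rightarrow> 'u) category" where
  "dfa_JSL = \<lparr>Obj = {A. jsl_dfa A}, Hom = jsl_dfa_hom,
     Ident = (\<lambda>A. restrict id (carrier (jsl A))),
     Comp = (\<lambda>A B D f g. compose (carrier (jsl A)) g f)\<rparr>"

definition opens :: "'x hf dep \<Rightarrow> 'x hf set" where
  "opens G = {hf_set (rel G `` X) |X. X \<subseteq> src G}"

text \<open>Sets are encoded by \<open>hf_set\<close> and decoded by \<open>elts\<close>. The order of \<open>(O(G), \<union>, \<emptyset>)\<close> is inclusion.\<close>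

definition Open_obj :: "'x hf dep \<Rightarrow> 'x hf gorder" where
  "Open_obj G = \<lparr>carrier = opens G, eq = (=),
     le = (\<lambda>Y Z. Y \<in> opens G \<and> Z \<in> opens G \<and> elts Y \<subseteq> elts Z)\<rparr>"

definition Open_hom :: "'x hf dep \<Rightarrow> 'x hf dep \<Rightarrow> 'x hf rel \<Rightarrow> 'x hf \<Rightarrow> 'x hf" where
  "Open_hom G H R = (\<lambda>Y \<in> opens G. hf_set ((dep_plus G H R)\<inverse> `` elts Y))"

definition Pirr_obj :: "'u gorder \<Rightarrow> 'u dep" where
  "Pirr_obj S = \<lparr>src = join_irr S, tgt = meet_irr S,
     rel = {(j, m). j \<in> join_irr S \<and> m \<in> meet_irr S \<and> \<not> j \<sqsubseteq>\<^bsub>S\<^esub> m}\<rparr>"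

definition Pirr_hom :: "'u gorder \<Rightarrow> 'u gorder \<Rightarrow> ('u \<Rightarrow> 'u) \<Rightarrow> 'u rel" where
  "Pirr_hom S T f = {(j, m). j \<in> join_irr S \<and> m \<in> meet_irr T \<and> \<not> f j \<sqsubseteq>\<^bsub>T\<^esub> m}"

definition Det :: "(('a, 'x hf) dep_aut, 'x hf rel, ('a, 'x hf) jsl_dfa, 'x hf \<Rightarrow> 'x hf) funct" where
  "Det = \<lparr>
     on_obj = (\<lambda>A. \<lparr>
       start = hf_set (final (upper A)),
       jsl = Open_obj (base A),
       delta = (\<lambda>a. \<lambda>Y \<in> opens (base A). hf_set ((step (upper A) a)\<inverse> `` elts Y)),
       accept = {Y \<in> opens (base A). elts Y \<inter> init (upper A) \<noteq> {}}\<rparr>),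
     on_hom = (\<lambda>A B R. Open_hom (base A) (base B) R)\<rparr>"

text \<open>
  In \<open>Airr\<close>, the transitions \<open>(Pirr \<delta>\<^sub>a)\<^sub>-\<close> and \<open>(Pirr \<delta>\<^sub>a)\<^sub>+\<close> are the largest witnesses of the morphism
  \<open>Pirr \<delta>\<^sub>a\<close> in Dep. They relate \<open>j\<^sub>1, j\<^sub>2\<close> iff \<open>j\<^sub>2 \<le> \<delta>\<^sub>a j\<^sub>1\<close>, and \<open>m\<^sub>1, m\<^sub>2\<close> iff the adjoint of \<open>\<delta>\<^sub>a\<close> maps \<open>m\<^sub>1\<close>
  below \<open>m\<^sub>2\<close>.
\<close>

definition Airr :: "(('a, 'u) jsl_dfa, 'u \<Rightarrow> 'u, ('a, 'u) dep_aut, 'u rel) funct" where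
  "Airr = \<lparr>
     on_obj = (\<lambda>A. let S = jsl A; P = Pirr_obj S in \<lparr>
       lower = \<lparr>
         states = join_irr S,
         init = {j \<in> join_irr S. j \<sqsubseteq>\<^bsub>S\<^esub> start A},
         step = (\<lambda>a. dep_minus P P (Pirr_hom S S (delta A a))),
         final = join_irr S \<inter> accept A\<rparr>,
       base = P,
       upper = \<lparr>
         states = meet_irr S,
         init = {m \<in> meet_irr S. \<Squnion>\<^bsub>S\<^esub> (carrier S - accept A) \<sqsubseteq>\<^bsub>S\<^esub> m},
         step = (\<lambda>a. dep_plus P P (Pirr_hom S S (delta A a))),
         final = {m \<in> meet_irr S. \<not> start A \<sqsubseteq>\<^bsub>S\<^esub> m}\<rparr>\<rparr>),
     on_hom = (\<lambda>A B f. Pirr_hom (jsl A) (jsl B) f)\<rparr>"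

definition rep :: "('a, 'x hf) jsl_dfa \<Rightarrow> 'x hf \<Rightarrow> 'x hf" where
  "rep A = (\<lambda>x \<in> carrier (jsl A). hf_set {m \<in> meet_irr (jsl A). \<not> x \<sqsubseteq>\<^bsub>jsl A\<^esub> m})"

definition red :: "('a, 'x hf) dep_aut \<Rightarrow> 'x hf rel" where
  "red A = (let G = base A in
     {(g, Y). g \<in> src G \<and> Y \<in> meet_irr (Open_obj G) \<and> \<not> rel G `` {g} \<subseteq> elts Y})"

end

theory Submission
  imports Defs
begin

text \<open>
  \<open>Det\<close> is fully faithful: a morphism \<open>R : \<G> \<rightarrow> \<H>\<close> in Dep acts on open sets by
  \<open>\<G>[X] \<mapsto> R[X]\<close>, so it is determined by \<open>Open R\<close>, and conversely every join-preserving
  \<open>f : Open \<G> \<rightarrow> Open \<H>\<close> arises from the relation with \<open>R[g] = f (\<G>[g])\<close>; the automata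
  conditions on \<open>R\<close> translate into those on \<open>f\<close>. The irreducibles separate the points of a finite
  semilattice, so \<open>rep\<close> is an isomorphism. Moreover \<open>Pirr f\<close> is the relation inducing the conjugate of
  \<open>f\<close> by \<open>rep\<close>, and \<open>red\<close> at \<open>A\<close> is the one inducing \<open>rep\<close> at \<open>Det A\<close>. Hence the functoriality of
  \<open>Airr\<close>, the naturality of \<open>red\<close> and its invertibility are reflected along \<open>Det\<close>, and so are
  the category axioms of \<open>aut_Dep\<close>.
\<close>

section \<open>Equivalences from fully faithful functors\<close>

context category
begin

text \<open>Composing with the inverse of \<open>e\<close> strips it off. Naturality of a family of
  isomorphisms compares morphisms only after such a precomposition.\<close>

lemma iso_cancel_left:
  assumes "is_iso C A B e" "A \<in> Obj C" "B \<in> Obj C" "D \<in> Obj C"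
    and "f \<in> Hom C B D" "g \<in> Hom C B D"
    and eq: "Comp C A B D e f = Comp C A B D e g"
  shows "f = g"
proof -
  obtain i where i: "i \<in> Hom C B A" "Comp C B A B i e = Ident C B" and e: "e \<in> Hom C A B"
    using assms(1) unfolding is_iso_def by blast
  have *: "Comp C B A D i (Comp C A B D e h) = h" if "h \<in> Hom C B D" for h
    using Comp_assoc[OF assms(3,2,3,4) i(1) e that] Ident_left[OF assms(3,4) that] i(2) by metis
  show ?thesis
    using *[OF assms(5)] *[OF assms(6)] eq by metis
qed

end

text \<open>\<open>C\<close> is only required to be closed under identities and composition; its
  laws are pulled back along the bijections of hom-sets. This spares a direct argument with the
  witnesses in \<open>dep_comp\<close>.\<close>

locale category_embedding = D: category D
  for C :: "('o1, 'm1) category" and D :: "('o2, 'm2) category"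
    and F :: "('o1, 'm1, 'o2, 'm2) funct" +
  assumes on_obj: "A \<in> Obj C \<Longrightarrow> on_obj F A \<in> Obj D"
    and bij: "\<lbrakk>A \<in> Obj C; B \<in> Obj C\<rbrakk>
      \<Longrightarrow> bij_betw (on_hom F A B) (Hom C A B) (Hom D (on_obj F A) (on_obj F B))"
    and Ident_closed: "A \<in> Obj C \<Longrightarrow> Ident C A \<in> Hom C A A"
    and on_Ident: "A \<in> Obj C \<Longrightarrow> on_hom F A A (Ident C A) = Ident D (on_obj F A)"
    and Comp_closed: "\<lbrakk>A \<in> Obj C; B \<in> Obj C; E \<in> Obj C; f \<in> Hom C A B; g \<in> Hom C B E\<rbrakk>
      \<Longrightarrow> Comp C A B E f g \<in> Hom C A E"
    and on_Comp: "\<lbrakk>A \<in> Obj C; B \<in> Obj C; E \<in> Obj C; f \<in> Hom C A B; g \<in> Hom C B E\<rbrakk>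
      \<Longrightarrow> on_hom F A E (Comp C A B E f g) =
          Comp D (on_obj F A) (on_obj F B) (on_obj F E) (on_hom F A B f) (on_hom F B E g)"
begin

lemma on_hom: "\<lbrakk>A \<in> Obj C; B \<in> Obj C; f \<in> Hom C A B\<rbrakk>
    \<Longrightarrow> on_hom F A B f \<in> Hom D (on_obj F A) (on_obj F B)"
  using bij bij_betw_apply by metis

lemma faithful: "\<lbrakk>A \<in> Obj C; B \<in> Obj C; f \<in> Hom C A B; g \<in> Hom C A B;
    on_hom F A B f = on_hom F A B g\<rbrakk> \<Longrightarrow> f = g"
  using bij_betw_imp_inj_on[OF bij] by (metis inj_onD)

lemma full:
  assumes "A \<in> Obj C" "B \<in> Obj C" "f \<in> Hom D (on_obj F A) (on_obj F B)"
  obtains g where "g \<in> Hom C A B" "on_hom F A B g = f"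
  using bij_betw_imp_surj_on[OF bij[OF assms(1,2)]] assms(3) that by (metis imageE)

text \<open>Both sides of each law have the same image in \<open>D\<close>, and \<open>F\<close> is
  injective on hom-sets.\<close>

lemma category: "category C"
proof
  fix A B E H f g h
  assume *: "A \<in> Obj C" "B \<in> Obj C" "E \<in> Obj C" "H \<in> Obj C"
    "f \<in> Hom C A B" "g \<in> Hom C B E" "h \<in> Hom C E H"
  show "Comp C A E H (Comp C A B E f g) h = Comp C A B H f (Comp C B E H g h)"
    by (rule faithful[of A H]) (simp_all add: * on_Comp Comp_closed D.Comp_assoc on_obj on_hom)
next
  fix A B f
  assume *: "A \<in> Obj C" "B \<in> Obj C" "f \<in> Hom C A B"
  show "Comp C A A B (Ident C A) f = f"
    by (rule faithful[of A B])
      (simp_all add: * on_Comp on_Ident Comp_closed Ident_closed D.Ident_left on_obj on_hom)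
  show "Comp C A B B f (Ident C B) = f"
    by (rule faithful[of A B])
      (simp_all add: * on_Comp on_Ident Comp_closed Ident_closed D.Ident_right on_obj on_hom)
qed (use Ident_closed Comp_closed in auto)

lemma is_functor: "is_functor C D F"
proof -
  interpret C: category C by (rule category)
  show ?thesis
    by unfold_locales (simp_all add: on_obj on_hom on_Ident on_Comp)
qed

text \<open>Fullness lifts the inverse to \<open>C\<close>, and faithfulness lifts the two
  equations.\<close>

lemma reflects_iso:
  assumes "A \<in> Obj C" "B \<in> Obj C" "f \<in> Hom C A B"
    and "is_iso D (on_obj F A) (on_obj F B) (on_hom F A B f)"
  shows "is_iso C A B f"
proof -
  obtain g' where g': "g' \<in> Hom D (on_obj F B) (on_obj F A)"
    "Comp D (on_obj F A) (on_obj F B) (on_obj F A) (on_hom F A B f) g' = Ident D (on_obj F A)"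
    "Comp D (on_obj F B) (on_obj F A) (on_obj F B) g' (on_hom F A B f) = Ident D (on_obj F B)"
    using assms(4) unfolding is_iso_def by blast
  obtain g where g: "g \<in> Hom C B A" "on_hom F B A g = g'"
    using full[OF assms(2,1) g'(1)] .
  have "Comp C A B A f g = Ident C A"
    by (rule faithful[of A A]) (simp_all add: assms g g' on_Comp on_Ident Comp_closed Ident_closed)
  moreover have "Comp C B A B g f = Ident C B"
    by (rule faithful[of B B]) (simp_all add: assms g g' on_Comp on_Ident Comp_closed Ident_closed)
  ultimately show ?thesis
    using assms g unfolding is_iso_def by blast
qed

text \<open>Naturality and invertibility of \<epsilon> make \<open>F\<close> after \<open>G\<close>
  a conjugation by \<epsilon>, hence functorial, and faithfulness passes this on to
  \<open>G\<close>. In the same way \<eta> inherits its properties from \<epsilon>, as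
  \<open>F\<close> sends it to a component of \<epsilon>.\<close>

lemma equivalence_of_categoriesI:
  assumes G_obj: "\<And>X. X \<in> Obj D \<Longrightarrow> on_obj G X \<in> Obj C"
    and G_hom: "\<And>X Y f. \<lbrakk>X \<in> Obj D; Y \<in> Obj D; f \<in> Hom D X Y\<rbrakk>
      \<Longrightarrow> on_hom G X Y f \<in> Hom C (on_obj G X) (on_obj G Y)"
    and eps_iso: "\<And>X. X \<in> Obj D \<Longrightarrow> is_iso D X (on_obj F (on_obj G X)) (\<epsilon> X)"
    and eps_natural: "\<And>X Y f. \<lbrakk>X \<in> Obj D; Y \<in> Obj D; f \<in> Hom D X Y\<rbrakk> \<Longrightarrow>
        Comp D X Y (on_obj F (on_obj G Y)) f (\<epsilon> Y) =
        Comp D X (on_obj F (on_obj G X)) (on_obj F (on_obj G Y)) (\<epsilon> X)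
          (on_hom F (on_obj G X) (on_obj G Y) (on_hom G X Y f))"
    and eta_hom: "\<And>A. A \<in> Obj C \<Longrightarrow> \<eta> A \<in> Hom C A (on_obj G (on_obj F A))"
    and eta_eps: "\<And>A. A \<in> Obj C \<Longrightarrow>
        on_hom F A (on_obj G (on_obj F A)) (\<eta> A) = \<epsilon> (on_obj F A)"
  shows "equivalence_of_categories C D F G \<eta> \<epsilon>"
proof -
  interpret C: category C by (rule category)
  interpret F: is_functor C D F by (rule is_functor)
  have eps_hom: "\<epsilon> X \<in> Hom D X (on_obj F (on_obj G X))" if "X \<in> Obj D" for X
    using eps_iso[OF that] unfolding is_iso_def by blast
  note simps = on_obj on_hom on_Ident on_Comp G_obj G_hom Ident_closed Comp_closed
    D.Ident_in_Hom D.Comp_in_Hom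
  interpret G: is_functor D C G
  proof
    fix X assume X: "X \<in> Obj D"
    let ?F = "on_hom F (on_obj G X) (on_obj G X)"
    \<comment> \<open>After precomposition with \<open>\<epsilon> X\<close>, naturality at the
      identity turns both sides into \<open>\<epsilon> X\<close>.\<close>
    have "?F (on_hom G X X (Ident D X)) = Ident D (on_obj F (on_obj G X))"
      by (rule D.iso_cancel_left[OF eps_iso[OF X], of "on_obj F (on_obj G X)"])
        (simp_all add: X simps eps_natural[symmetric] eps_hom D.Ident_left D.Ident_right)
    then show "on_hom G X X (Ident D X) = Ident C (on_obj G X)"
      by (intro faithful[of "on_obj G X" "on_obj G X"]) (simp_all add: X simps)
  next
    fix X Y Z f g
    assume *: "X \<in> Obj D" "Y \<in> Obj D" "Z \<in> Obj D" "f \<in> Hom D X Y" "g \<in> Hom D Y Z"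
    let ?FG = "\<lambda>X. on_obj F (on_obj G X)"
    let ?fg = "\<lambda>X Y f. on_hom F (on_obj G X) (on_obj G Y) (on_hom G X Y f)"
    \<comment> \<open>Naturality at the composite moves \<epsilon> to the right end; naturality at
      \<open>g\<close> and then at \<open>f\<close> moves it back, so that
      \<open>\<epsilon> X\<close> can be cancelled.\<close>
    have "Comp D X (?FG X) (?FG Z) (\<epsilon> X) (?fg X Z (Comp D X Y Z f g))
        = Comp D X Z (?FG Z) (Comp D X Y Z f g) (\<epsilon> Z)"
      by (simp add: * eps_natural D.Comp_in_Hom)
    also have "\<dots> = Comp D X Y (?FG Z) f (Comp D Y (?FG Y) (?FG Z) (\<epsilon> Y) (?fg Y Z g))"
      by (simp add: * D.Comp_assoc simps eps_hom eps_natural)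
    also have "\<dots> = Comp D X (?FG Y) (?FG Z) (Comp D X Y (?FG Y) f (\<epsilon> Y)) (?fg Y Z g)"
      by (rule D.Comp_assoc[symmetric]) (simp_all add: * simps eps_hom)
    also have "\<dots> = Comp D X (?FG X) (?FG Z) (\<epsilon> X)
        (Comp D (?FG X) (?FG Y) (?FG Z) (?fg X Y f) (?fg Y Z g))"
      by (simp add: * D.Comp_assoc simps eps_hom eps_natural)
    finally have "?fg X Z (Comp D X Y Z f g)
        = Comp D (?FG X) (?FG Y) (?FG Z) (?fg X Y f) (?fg Y Z g)"
      by (rule D.iso_cancel_left[OF eps_iso[OF *(1)], of "?FG Z", rotated -1])
        (simp_all add: * simps)
    then show "on_hom G X Z (Comp D X Y Z f g)
        = Comp C (on_obj G X) (on_obj G Y) (on_obj G Z) (on_hom G X Y f) (on_hom G Y Z g)"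
      by (intro faithful[of "on_obj G X" "on_obj G Z"]) (simp_all add: * simps)
  qed (simp_all add: simps)
  have GF: "is_functor C C (G \<circ>\<^sub>F F)"
    by unfold_locales (simp_all add: comp_functor_def simps G.on_hom_Ident G.on_hom_Comp)
  have FG: "is_functor D D (F \<circ>\<^sub>F G)"
    by unfold_locales (simp_all add: comp_functor_def simps G.on_hom_Ident G.on_hom_Comp)
  have idC: "is_functor C C id_functor"
    by unfold_locales (simp_all add: id_functor_def)
  have idD: "is_functor D D id_functor"
    by unfold_locales (simp_all add: id_functor_def)
  have "natural_isomorphism C C id_functor (G \<circ>\<^sub>F F) \<eta>"
  proof (intro natural_isomorphism.intro idC GF natural_isomorphism_axioms.intro)
    fix A B f
    assume *: "A \<in> Obj C" "B \<in> Obj C" "f \<in> Hom C A B"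
    show "Comp C (on_obj id_functor A) (on_obj id_functor B) (on_obj (G \<circ>\<^sub>F F) B)
        (on_hom id_functor A B f) (\<eta> B)
      = Comp C (on_obj id_functor A) (on_obj (G \<circ>\<^sub>F F) A) (on_obj (G \<circ>\<^sub>F F) B) (\<eta> A)
        (on_hom (G \<circ>\<^sub>F F) A B f)"
      unfolding id_functor_def comp_functor_def funct.simps
      \<comment> \<open>Under \<open>F\<close> this becomes the naturality square of \<epsilon> at
        the image of \<open>f\<close>.\<close>
      by (rule faithful[of A "on_obj G (on_obj F B)"])
        (simp_all add: * simps eta_hom eta_eps eps_natural)
  next
    fix A assume A: "A \<in> Obj C"
    show "is_iso C (on_obj id_functor A) (on_obj (G \<circ>\<^sub>F F) A) (\<eta> A)"
      unfolding id_functor_def comp_functor_def funct.simps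
      by (rule reflects_iso) (simp_all add: A simps eta_hom eta_eps eps_iso)
  qed
  moreover have "natural_isomorphism D D id_functor (F \<circ>\<^sub>F G) \<epsilon>"
    by (intro natural_isomorphism.intro idD FG natural_isomorphism_axioms.intro)
      (simp_all add: id_functor_def comp_functor_def eps_natural eps_iso)
  ultimately show ?thesis
    using F.is_functor_axioms G.is_functor_axioms by (simp add: equivalence_of_categories_def)
qed

end


section \<open>Finite join-semilattices\<close>

context finite_jsl
begin

text \<open>The empty join is a separate case: every carrier element bounds the empty set, so its
  least upper bound is bottom.\<close>

lemma sup_least: "A \<subseteq> carrier L \<Longrightarrow> least L (\<Squnion>A) (Upper L A)"
proof (cases "A = {}")
  case True
  then show ?thesis
    using bottom_exists someI_ex[of "\<lambda>x. least L x (carrier L)"] by (simp add: sup_def)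
next
  case False
  moreover assume "A \<subseteq> carrier L"
  ultimately show ?thesis
    using finite_sup_least finite_subset[OF _ finite_carrier] by blast
qed

lemma sup_closed: "A \<subseteq> carrier L \<Longrightarrow> \<Squnion>A \<in> carrier L"
  using sup_least least_closed by blast

lemma sup_upper: "\<lbrakk>A \<subseteq> carrier L; x \<in> A\<rbrakk> \<Longrightarrow> x \<sqsubseteq> \<Squnion>A"
  using sup_least least_Upper_above by metis

lemma sup_le_iff:
  assumes "A \<subseteq> carrier L" "y \<in> carrier L"
  shows "\<Squnion>A \<sqsubseteq> y \<longleftrightarrow> (\<forall>x\<in>A. x \<sqsubseteq> y)"
proof
  assume "\<Squnion>A \<sqsubseteq> y"
  then show "\<forall>x\<in>A. x \<sqsubseteq> y"
    using assms sup_upper[OF assms(1)] sup_closed[OF assms(1)] by (meson le_trans subsetD)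
next
  assume "\<forall>x\<in>A. x \<sqsubseteq> y"
  then have "y \<in> Upper L A"
    using assms(2) by (auto intro: Upper_memI)
  then show "\<Squnion>A \<sqsubseteq> y"
    using least_le[OF sup_least[OF assms(1)]] by blast
qed

lemma sup_eqI:
  assumes "A \<subseteq> carrier L" "x \<in> carrier L"
    and "\<And>a. a \<in> A \<Longrightarrow> a \<sqsubseteq> x"
    and "\<And>y. \<lbrakk>y \<in> carrier L; \<And>a. a \<in> A \<Longrightarrow> a \<sqsubseteq> y\<rbrakk> \<Longrightarrow> x \<sqsubseteq> y"
  shows "\<Squnion>A = x"
  by (meson assms le_antisym sup_closed sup_le_iff sup_upper)

lemma greatest_top: "greatest L \<top> (carrier L)"
  unfolding top_def
  by (rule someI[of _ "\<Squnion>(carrier L)"]) (simp add: greatest_def sup_closed sup_upper)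

text \<open>Meets come from joins: the join of all lower bounds of \<open>x\<close> and
  \<open>y\<close> is itself a lower bound.\<close>

lemma greatest_meet:
  assumes "x \<in> carrier L" "y \<in> carrier L"
  shows "greatest L (x \<sqinter> y) (Lower L {x, y})"
  unfolding meet_def inf_def
proof (rule someI[of _ "\<Squnion>(Lower L {x, y})"])
  show "greatest L (\<Squnion>(Lower L {x, y})) (Lower L {x, y})"
    using assms by (intro greatest_LowerI) (auto simp: sup_le_iff sup_upper sup_closed Lower_def)
qed

lemma le_meet_iff:
  assumes "x \<in> carrier L" "y \<in> carrier L" "z \<in> carrier L"
  shows "z \<sqsubseteq> x \<sqinter> y \<longleftrightarrow> z \<sqsubseteq> x \<and> z \<sqsubseteq> y"
proof -
  have "x \<sqinter> y \<in> carrier L" "x \<sqinter> y \<sqsubseteq> x" "x \<sqinter> y \<sqsubseteq> y"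
    and "z \<sqsubseteq> x \<and> z \<sqsubseteq> y \<Longrightarrow> z \<sqsubseteq> x \<sqinter> y"
    using greatest_meet[OF assms(1,2)] assms by (auto simp: greatest_def Lower_def)
  then show ?thesis
    using assms by (meson le_trans)
qed

section \<open>Separation by irreducible elements\<close>

lemma asymp_transp_less:
  assumes "A \<subseteq> carrier L"
  shows "asymp_on A (\<sqsubset>)" "transp_on A (\<sqsubset>)"
proof -
  show "asymp_on A (\<sqsubset>)"
    using assms by (intro asymp_onI) (meson lless_antisym subsetD)
  show "transp_on A (\<sqsubset>)"
    using assms by (intro transp_onI) (meson lless_trans subsetD)
qed

text \<open>Take \<open>m\<close> maximal among the elements above \<open>y\<close> and not above
  \<open>x\<close>. Everything strictly above \<open>m\<close> lies above \<open>x\<close>, so a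
  meet of two such elements does too and cannot be \<open>m\<close>; nor can the top, which is above
  \<open>x\<close>.\<close>

lemma meet_irr_separates:
  assumes "x \<in> carrier L" "y \<in> carrier L" "\<not> x \<sqsubseteq> y"
  obtains m where "m \<in> meet_irr L" "y \<sqsubseteq> m" "\<not> x \<sqsubseteq> m"
proof -
  let ?U = "{m \<in> carrier L. y \<sqsubseteq> m \<and> \<not> x \<sqsubseteq> m}"
  have "\<exists>m\<in>?U. \<forall>b\<in>?U. b \<noteq> m \<longrightarrow> \<not> m \<sqsubset> b"
    using finite_carrier assms
    by (intro Finite_Set.bex_max_element[OF _ asymp_transp_less]) auto
  then obtain m where m: "m \<in> carrier L" "y \<sqsubseteq> m" "\<not> x \<sqsubseteq> m"
    and max: "\<And>b. \<lbrakk>b \<in> carrier L; y \<sqsubseteq> b; \<not> x \<sqsubseteq> b; m \<sqsubseteq> b\<rbrakk> \<Longrightarrow> m = b"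
    unfolding lless_eq mem_Collect_eq bex_simps by (metis (no_types, lifting) mem_Collect_eq)
  have up: "x \<sqsubseteq> b" if "b \<in> carrier L" "m \<sqsubseteq> b" "m \<noteq> b" for b
    using max le_trans[of y m b] m assms that by blast
  have "m \<noteq> \<top>"
    using greatest_top m(3) assms(1) greatest_le by metis
  moreover have "m = a \<or> m = b" if "a \<in> carrier L" "b \<in> carrier L" "m = a \<sqinter> b" for a b
  proof (rule ccontr)
    assume ne: "\<not> (m = a \<or> m = b)"
    have "m \<sqsubseteq> a" "m \<sqsubseteq> b"
      using le_meet_iff[OF that(1,2) m(1)] le_refl[OF m(1)] that(3) by auto
    then have "x \<sqsubseteq> m"
      using up that(1,2) ne le_meet_iff[OF that(1,2) assms(1)] that(3) by auto
    then show False
      using m(3) by blast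
  qed
  ultimately have "m \<in> meet_irr L"
    using m(1) unfolding meet_irr_def by blast
  then show ?thesis
    using that m by blast
qed

text \<open>Dually, \<open>j\<close> is minimal among the elements below \<open>x\<close> and not
  below \<open>y\<close>: everything strictly below it lies below \<open>y\<close>, and so does the
  join of two such elements.\<close>

lemma join_irr_separates:
  assumes "x \<in> carrier L" "y \<in> carrier L" "\<not> x \<sqsubseteq> y"
  obtains j where "j \<in> join_irr L" "j \<sqsubseteq> x" "\<not> j \<sqsubseteq> y"
proof -
  let ?U = "{j \<in> carrier L. j \<sqsubseteq> x \<and> \<not> j \<sqsubseteq> y}"
  have "\<exists>j\<in>?U. \<forall>b\<in>?U. b \<noteq> j \<longrightarrow> \<not> b \<sqsubset> j"
    using finite_carrier assms
    by (intro Finite_Set.bex_min_element[OF _ asymp_transp_less]) auto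
  then obtain j where j: "j \<in> carrier L" "j \<sqsubseteq> x" "\<not> j \<sqsubseteq> y"
    and min: "\<And>b. \<lbrakk>b \<in> carrier L; b \<sqsubseteq> x; \<not> b \<sqsubseteq> y; b \<sqsubseteq> j\<rbrakk> \<Longrightarrow> b = j"
    unfolding lless_eq by (metis (no_types, lifting) mem_Collect_eq)
  have down: "b \<sqsubseteq> y" if "b \<in> carrier L" "b \<sqsubseteq> j" "b \<noteq> j" for b
    using min le_trans[of b j x] j assms that by blast
  have "j \<noteq> \<bottom>"
    using bottom_lower j(3) assms(2) by metis
  moreover have "j = a \<or> j = b" if "a \<in> carrier L" "b \<in> carrier L" "j = a \<squnion> b" for a b
  proof (rule ccontr)
    assume ne: "\<not> (j = a \<or> j = b)"
    have "a \<sqsubseteq> j" "b \<sqsubseteq> j"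
      using join_left[OF that(1,2)] join_right[OF that(1,2)] that(3) by auto
    then have "j \<sqsubseteq> y"
      using down that(1,2) ne join_le[OF _ _ that(1,2) assms(2)] that(3) by auto
    then show False
      using j(3) by blast
  qed
  ultimately have "j \<in> join_irr L"
    using j(1) unfolding join_irr_def by blast
  then show ?thesis
    using that j by blast
qed

text \<open>If an upper bound of these join-irreducibles were not above \<open>x\<close>, one of
  them would separate \<open>x\<close> from it.\<close>

lemma sup_join_irr_below:
  assumes "x \<in> carrier L"
  shows "\<Squnion>{j \<in> join_irr L. j \<sqsubseteq> x} = x"
proof (rule sup_eqI)
  show "{j \<in> join_irr L. j \<sqsubseteq> x} \<subseteq> carrier L"
    unfolding join_irr_def by blast
  show "x \<sqsubseteq> y" if "y \<in> carrier L" "\<And>a. a \<in> {j \<in> join_irr L. j \<sqsubseteq> x} \<Longrightarrow> a \<sqsubseteq> y" for y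
    using join_irr_separates[OF assms that(1)] that(2) by blast
qed (use assms in auto)

end

section \<open>Join-preserving maps\<close>

lemma jsl_hom_closed: "\<lbrakk>f \<in> jsl_hom S T; x \<in> carrier S\<rbrakk> \<Longrightarrow> f x \<in> carrier T"
  unfolding jsl_hom_def by blast

lemma jsl_hom_sup: "\<lbrakk>f \<in> jsl_hom S T; A \<subseteq> carrier S\<rbrakk> \<Longrightarrow> f (\<Squnion>\<^bsub>S\<^esub> A) = \<Squnion>\<^bsub>T\<^esub> (f ` A)"
  unfolding jsl_hom_def by blast

lemma jsl_hom_ext: "f \<in> jsl_hom S T \<Longrightarrow> f \<in> extensional (carrier S)"
  unfolding jsl_hom_def by (blast dest: PiE_iff[THEN iffD1])

lemma jsl_hom_id:
  assumes "finite_jsl S"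
  shows "restrict id (carrier S) \<in> jsl_hom S S"
proof -
  have "restrict id (carrier S) ` A = A" if "A \<subseteq> carrier S" for A
    using that by force
  then show ?thesis
    using finite_jsl.sup_closed[OF assms] by (auto simp: jsl_hom_def)
qed

lemma jsl_hom_compose:
  assumes "finite_jsl S" "f \<in> jsl_hom S T" "g \<in> jsl_hom T U"
  shows "compose (carrier S) g f \<in> jsl_hom S U"
proof -
  have "compose (carrier S) g f (\<Squnion>\<^bsub>S\<^esub> A) = \<Squnion>\<^bsub>U\<^esub> (compose (carrier S) g f ` A)"
    if "A \<subseteq> carrier S" for A
  proof -
    have "compose (carrier S) g f (\<Squnion>\<^bsub>S\<^esub> A) = g (\<Squnion>\<^bsub>T\<^esub> (f ` A))"
      using finite_jsl.sup_closed[OF assms(1) that] jsl_hom_sup[OF assms(2) that]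
      by (simp add: compose_eq)
    also have "\<dots> = \<Squnion>\<^bsub>U\<^esub> (g ` f ` A)"
      using that assms(2) by (intro jsl_hom_sup[OF assms(3)]) (auto dest: jsl_hom_closed)
    also have "g ` f ` A = compose (carrier S) g f ` A"
      using that by (auto simp: compose_eq image_iff subset_iff)
    finally show ?thesis .
  qed
  then show ?thesis
    using jsl_hom_closed[OF assms(2)] jsl_hom_closed[OF assms(3)]
    by (simp add: jsl_hom_def compose_def)
qed

text \<open>Both sides of the join equation for the inverse have the same value under
  \<open>f\<close>, which is injective.\<close>

lemma jsl_hom_inv_into:
  assumes "finite_jsl S" "finite_jsl T" "f \<in> jsl_hom S T" "bij_betw f (carrier S) (carrier T)"
  shows "restrict (inv_into (carrier S) f) (carrier T) \<in> jsl_hom T S"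
proof -
  let ?g = "restrict (inv_into (carrier S) f) (carrier T)"
  have g: "?g y \<in> carrier S" "f (?g y) = y" if "y \<in> carrier T" for y
    using assms(4) that by (auto simp: bij_betw_def inv_into_into f_inv_into_f)
  have "?g (\<Squnion>\<^bsub>T\<^esub> A) = \<Squnion>\<^bsub>S\<^esub> (?g ` A)" if "A \<subseteq> carrier T" for A
  proof -
    have sub: "?g ` A \<subseteq> carrier S"
      using that g by blast
    have "f ` ?g ` A = A"
      using that g(2) by (force simp: image_iff)
    then have "f (\<Squnion>\<^bsub>S\<^esub> (?g ` A)) = \<Squnion>\<^bsub>T\<^esub> A"
      using jsl_hom_sup[OF assms(3) sub] by simp
    then have "f (?g (\<Squnion>\<^bsub>T\<^esub> A)) = f (\<Squnion>\<^bsub>S\<^esub> (?g ` A))"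
      using g(2)[OF finite_jsl.sup_closed[OF assms(2) that]] by metis
    then show ?thesis
      by (rule inj_onD[OF bij_betw_imp_inj_on[OF assms(4)]])
        (rule g(1)[OF finite_jsl.sup_closed[OF assms(2) that]],
          rule finite_jsl.sup_closed[OF assms(1) sub])
  qed
  then show ?thesis
    using g(1) unfolding jsl_hom_def by (simp add: PiE_iff)
qed

section \<open>The dependency category and open sets\<close>

lemma elts_hf_set: "finite A \<Longrightarrow> elts (hf_set A) = A"
  by (simp add: hf_set_def Abs_fset_inverse)

lemma dep_image_finite: "dep_obj G \<Longrightarrow> finite (rel G `` X)"
  unfolding dep_obj_def by (auto intro: finite_subset[of _ "tgt G"])

lemma elts_open: "dep_obj G \<Longrightarrow> elts (hf_set (rel G `` X)) = rel G `` X"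
  by (simp add: elts_hf_set dep_image_finite)

lemma open_in_opens:
  assumes "dep_obj G"
  shows "hf_set (rel G `` X) \<in> opens G"
proof -
  have "rel G `` X = rel G `` (X \<inter> src G)"
    using assms unfolding dep_obj_def by blast
  then show ?thesis
    unfolding opens_def by (metis (mono_tags) Int_lower2 mem_Collect_eq)
qed

lemma opensE:
  assumes "Y \<in> opens G"
  obtains X where "X \<subseteq> src G" "Y = hf_set (rel G `` X)"
  using assms unfolding opens_def by blast

lemma hf_set_elts_open: "\<lbrakk>dep_obj G; Y \<in> opens G\<rbrakk> \<Longrightarrow> hf_set (elts Y) = Y"
  by (elim opensE) (simp add: elts_open)

lemma open_eqI: "\<lbrakk>dep_obj G; Y \<in> opens G; Z \<in> opens G; elts Y = elts Z\<rbrakk> \<Longrightarrow> Y = Z"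
  by (metis hf_set_elts_open)

lemma elts_open_subset: "\<lbrakk>dep_obj G; Y \<in> opens G\<rbrakk> \<Longrightarrow> elts Y \<subseteq> tgt G"
  by (elim opensE) (auto simp: elts_open dep_obj_def)

lemma open_as_image:
  assumes "dep_obj G" "Y \<in> opens G"
  obtains X where "X \<subseteq> src G" "elts Y = rel G `` X"
  using assms by (elim opensE) (simp add: elts_open)

text \<open>Choose for each member of \<open>A\<close> a set whose image it is; since images commute
  with unions, the union is the image of all these sets together.\<close>

lemma Union_open:
  assumes G: "dep_obj G" and A: "A \<subseteq> opens G"
  shows "hf_set (\<Union>(elts ` A)) \<in> opens G" "elts (hf_set (\<Union>(elts ` A))) = \<Union>(elts ` A)"
proof -
  have "\<forall>Y\<in>A. \<exists>X. elts Y = rel G `` X"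
    using open_as_image[OF G] A by (metis subsetD)
  then obtain X where X: "\<And>Y. Y \<in> A \<Longrightarrow> elts Y = rel G `` X Y"
    by metis
  then have *: "\<Union>(elts ` A) = rel G `` (\<Union>(X ` A))"
    by auto
  show "hf_set (\<Union>(elts ` A)) \<in> opens G" "elts (hf_set (\<Union>(elts ` A))) = \<Union>(elts ` A)"
    unfolding * using G by (auto simp: open_in_opens elts_open)
qed

lemma finite_opens:
  assumes "dep_obj G"
  shows "finite (opens G)"
proof -
  have "opens G = (\<lambda>X. hf_set (rel G `` X)) ` Pow (src G)"
    unfolding opens_def by blast
  then show ?thesis
    using assms by (simp add: dep_obj_def)
qed

section \<open>The semilattice of open sets\<close>

lemma carrier_Open [simp]: "carrier (Open_obj G) = opens G"
  by (simp add: Open_obj_def)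

lemma le_Open [simp]: "Y \<sqsubseteq>\<^bsub>Open_obj G\<^esub> Z \<longleftrightarrow> Y \<in> opens G \<and> Z \<in> opens G \<and> elts Y \<subseteq> elts Z"
  by (simp add: Open_obj_def)

lemma least_Union_open:
  assumes "dep_obj G" "A \<subseteq> opens G"
  shows "least (Open_obj G) (hf_set (\<Union>(elts ` A))) (Upper (Open_obj G) A)"
  using Union_open[OF assms] assms(2) by (auto simp: least_def Upper_def)

lemma finite_jsl_Open:
  assumes "dep_obj G"
  shows "finite_jsl (Open_obj G)"
proof
  show "\<exists>s. least (Open_obj G) s (Upper (Open_obj G) {x, y})"
    if "x \<in> carrier (Open_obj G)" "y \<in> carrier (Open_obj G)" for x y
    using least_Union_open[OF assms, of "{x, y}"] that by auto
  show "\<exists>x. least (Open_obj G) x (carrier (Open_obj G))"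
    using least_Union_open[OF assms, of "{}"] by auto
  show "(.=\<^bsub>Open_obj G\<^esub>) = (=)"
    by (simp add: Open_obj_def)
qed (auto simp: Open_obj_def finite_opens[OF assms] intro: open_eqI[OF assms])

lemma sup_Open:
  assumes "dep_obj G" "A \<subseteq> opens G"
  shows "\<Squnion>\<^bsub>Open_obj G\<^esub> A = hf_set (\<Union>(elts ` A))"
proof -
  interpret finite_jsl "Open_obj G"
    by (rule finite_jsl_Open[OF assms(1)])
  show ?thesis
    using least_unique[OF sup_least least_Union_open[OF assms]] assms(2) by simp
qed

lemma elts_sup_Open:
  "\<lbrakk>dep_obj G; A \<subseteq> opens G\<rbrakk> \<Longrightarrow> elts (\<Squnion>\<^bsub>Open_obj G\<^esub> A) = \<Union>(elts ` A)"
  by (simp add: sup_Open Union_open)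

text \<open>\<open>G[X]\<close> is the join of the sets \<open>G[{x}]\<close>, so a join-preserving
  map is determined by its values on these generators.\<close>

lemma elts_jsl_hom_open:
  assumes G: "dep_obj G" and H: "dep_obj H" and f: "f \<in> jsl_hom (Open_obj G) (Open_obj H)"
  shows "elts (f (hf_set (rel G `` X))) = (\<Union>x\<in>X. elts (f (hf_set (rel G `` {x}))))"
proof -
  let ?A = "(\<lambda>x. hf_set (rel G `` {x})) ` X"
  have A: "?A \<subseteq> opens G"
    using open_in_opens[OF G] by auto
  have "rel G `` X = \<Union>(elts ` ?A)"
    by (auto simp: elts_open[OF G])
  then have "hf_set (rel G `` X) = \<Squnion>\<^bsub>Open_obj G\<^esub> ?A"
    using sup_Open[OF G A] by simp
  then have "f (hf_set (rel G `` X)) = \<Squnion>\<^bsub>Open_obj H\<^esub> (f ` ?A)"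
    using jsl_hom_sup[OF f, of ?A] A by simp
  moreover have "f ` ?A \<subseteq> opens H"
    using jsl_hom_closed[OF f] A by auto
  ultimately show ?thesis
    using elts_sup_Open[OF H, of "f ` ?A"] by simp
qed

text \<open>Images under a relation commute with unions, and the last hypothesis keeps them open.
  Both \<open>Open_hom\<close> and the transitions of \<open>Det\<close> have this form.\<close>

lemma image_jsl_hom:
  assumes G: "dep_obj G" and H: "dep_obj H" and "P \<subseteq> tgt G \<times> tgt H"
    and "\<And>X. X \<subseteq> src G \<Longrightarrow> \<exists>X'. P `` (rel G `` X) = rel H `` X'"
  shows "(\<lambda>Y \<in> opens G. hf_set (P `` elts Y)) \<in> jsl_hom (Open_obj G) (Open_obj H)"
    (is "?f \<in> _")
proof -
  have fin: "finite (P `` B)" for B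
    using assms(3) H by (auto intro: finite_subset[of _ "tgt H"] simp: dep_obj_def)
  have closed: "hf_set (P `` elts Y) \<in> opens H" if "Y \<in> opens G" for Y
    using open_as_image[OF G that] assms(4) open_in_opens[OF H] by metis
  have "?f (\<Squnion>\<^bsub>Open_obj G\<^esub> A) = \<Squnion>\<^bsub>Open_obj H\<^esub> (?f ` A)" if A: "A \<subseteq> opens G" for A
  proof -
    have B: "?f ` A \<subseteq> opens H"
      using A closed by auto
    have "\<Union>(elts ` ?f ` A) = (\<Union>Y\<in>A. P `` elts Y)"
      using A fin by (auto simp: elts_hf_set subset_iff)
    also have "\<dots> = P `` (\<Union>(elts ` A))"
      by blast
    finally show ?thesis
      using sup_Open[OF H B] sup_Open[OF G A] Union_open[OF G A] by simp
  qed
  then show ?thesis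
    using closed by (simp add: jsl_hom_def)
qed

section \<open>Morphisms of Dep and their action on open sets\<close>

lemma dep_hom_subset: "R \<in> dep_hom G H \<Longrightarrow> R \<subseteq> src G \<times> tgt H"
  unfolding dep_hom_def by blast

text \<open>Any witness is contained in \<open>dep_plus\<close>, so the composite covers
  \<open>R\<close>; the definition of \<open>dep_plus\<close> keeps it from exceeding
  \<open>R\<close>. The lower witness behaves in the same way.\<close>

lemma dep_hom_plus:
  assumes "R \<in> dep_hom G H"
  shows "rel G O (dep_plus G H R)\<inverse> = R"
proof -
  obtain Ru where "Ru \<subseteq> tgt H \<times> tgt G" "R = rel G O Ru\<inverse>"
    using assms unfolding dep_hom_def by blast
  then show ?thesis
    unfolding dep_plus_def by blast
qed

lemma dep_hom_minus:
  assumes "R \<in> dep_hom G H"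
  shows "dep_minus G H R O rel H = R"
proof -
  obtain Rl where "Rl \<subseteq> src G \<times> src H" "Rl O rel H = R"
    using assms unfolding dep_hom_def by blast
  then show ?thesis
    unfolding dep_minus_def by blast
qed

text \<open>This exhibits \<open>R[X]\<close> as an open set of \<open>H\<close>; its companion for
  \<open>dep_plus\<close> shows that \<open>R[X]\<close> depends on \<open>X\<close> only through
  \<open>G[X]\<close>.\<close>

lemma image_minus: "R \<in> dep_hom G H \<Longrightarrow> rel H `` (dep_minus G H R `` X) = R `` X"
  using dep_hom_minus relcomp_Image by metis

lemma image_plus: "R \<in> dep_hom G H \<Longrightarrow> (dep_plus G H R)\<inverse> `` (rel G `` X) = R `` X"
  using dep_hom_plus relcomp_Image by metis

lemma Open_hom_open:
  "\<lbrakk>dep_obj G; R \<in> dep_hom G H\<rbrakk> \<Longrightarrow> Open_hom G H R (hf_set (rel G `` X)) = hf_set (R `` X)"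
  by (simp add: Open_hom_def open_in_opens elts_open image_plus)

lemma dep_hom_image_open:
  assumes "dep_obj H" "R \<in> dep_hom G H"
  shows "hf_set (R `` X) \<in> opens H" "elts (hf_set (R `` X)) = R `` X"
  using open_in_opens[OF assms(1)] elts_open[OF assms(1)] image_minus[OF assms(2)] by metis+

lemma Open_hom_jsl_hom:
  assumes "dep_obj G" "dep_obj H" "R \<in> dep_hom G H"
  shows "Open_hom G H R \<in> jsl_hom (Open_obj G) (Open_obj H)"
  unfolding Open_hom_def
proof (rule image_jsl_hom[OF assms(1,2)])
  show "(dep_plus G H R)\<inverse> \<subseteq> tgt G \<times> tgt H"
    unfolding dep_plus_def by blast
  show "\<exists>X'. (dep_plus G H R)\<inverse> `` (rel G `` X) = rel H `` X'" for X
    using image_plus[OF assms(3)] image_minus[OF assms(3)] by metis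
qed

text \<open>For the upper witness at \<open>(g, h) \<in> R\<close>, take the union of all open sets whose image under \<open>f\<close>
  misses \<open>h\<close>. It does not contain \<open>rel G `` {g}\<close>, and any \<open>t\<close> in the difference is a witness.\<close>

lemma dep_hom_of_jsl_hom:
  assumes G: "dep_obj G" and H: "dep_obj H"
    and f: "f \<in> jsl_hom (Open_obj G) (Open_obj H)"
    and R: "R \<subseteq> src G \<times> tgt H"
    and fR: "\<And>g. g \<in> src G \<Longrightarrow> f (hf_set (rel G `` {g})) = hf_set (R `` {g})"
  shows "R \<in> dep_hom G H" "Open_hom G H R = f"
proof -
  have "finite (R `` {g})" for g
    using R H by (auto intro: finite_subset[of _ "tgt H"] simp: dep_obj_def)
  then have elts: "elts (f (hf_set (rel G `` {g}))) = R `` {g}" if "g \<in> src G" for g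
    by (simp add: fR[OF that] elts_hf_set)
  have f_open: "elts (f (hf_set (rel G `` X))) = R `` X" if "X \<subseteq> src G" for X
  proof -
    have "(\<Union>x\<in>X. elts (f (hf_set (rel G `` {x})))) = (\<Union>x\<in>X. R `` {x})"
      using elts that by (intro SUP_cong) auto
    then show ?thesis
      unfolding elts_jsl_hom_open[OF G H f, of X] by (simp add: Image_eq_UN[of R X])
  qed
  \<comment> \<open>As \<open>f\<close> takes open values, \<open>R[{g}]\<close> is
    \<open>H[X]\<close> for some \<open>X\<close>; \<open>dep_minus\<close> then relates
    \<open>g\<close> to each point of \<open>X\<close>, and one of these reaches
    \<open>h\<close>.\<close>
  have "dep_minus G H R O rel H = R"
  proof (intro equalityI subsetI; clarify)
    fix g h assume gh: "(g, h) \<in> R"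
    then have g: "g \<in> src G"
      using R by blast
    have "f (hf_set (rel G `` {g})) \<in> opens H"
      using jsl_hom_closed[OF f] open_in_opens[OF G] by simp
    then obtain X where "X \<subseteq> src H" "R `` {g} = rel H `` X"
      using open_as_image[OF H] elts[OF g] by metis
    then show "(g, h) \<in> dep_minus G H R O rel H"
      using gh g unfolding dep_minus_def by blast
  qed (auto simp: dep_minus_def)
  moreover have "rel G O (dep_plus G H R)\<inverse> = R"
  proof (intro equalityI subsetI; clarify)
    fix g h assume gh: "(g, h) \<in> R"
    then have g: "g \<in> src G" and h: "h \<in> tgt H"
      using R by auto
    define X where "X = {x \<in> src G. (x, h) \<notin> R}"
    have "h \<notin> elts (f (hf_set (rel G `` X)))"
      using f_open[of X] by (auto simp: X_def)
    \<comment> \<open>Otherwise \<open>X\<close> and \<open>insert g X\<close> would have the same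
      image under \<open>G\<close>, hence under \<open>R\<close>, although only the larger one
      reaches \<open>h\<close>.\<close>
    have "\<not> rel G `` {g} \<subseteq> rel G `` X"
    proof
      assume "rel G `` {g} \<subseteq> rel G `` X"
      then have "rel G `` (insert g X) = rel G `` X"
        by blast
      then have "R `` (insert g X) = R `` X"
        using f_open[of "insert g X"] f_open[of X] g by (simp add: X_def)
      then show False
        using gh by (auto simp: X_def)
    qed
    then obtain t where t: "(g, t) \<in> rel G" "t \<notin> rel G `` X"
      by blast
    \<comment> \<open>A predecessor of \<open>t\<close> not \<open>R\<close>-related to
      \<open>h\<close> would lie in \<open>X\<close> and put \<open>t\<close> into
      \<open>G[X]\<close>.\<close>
    then have "(rel G)\<inverse> `` {t} \<subseteq> R\<inverse> `` {h}"
      using G unfolding X_def dep_obj_def by blast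
    then have "(h, t) \<in> dep_plus G H R"
      using h t G unfolding dep_plus_def dep_obj_def by blast
    then show "(g, h) \<in> rel G O (dep_plus G H R)\<inverse>"
      using t by blast
  qed (auto simp: dep_plus_def)
  ultimately show hom: "R \<in> dep_hom G H"
    using R unfolding dep_hom_def
    by (intro CollectI conjI exI[of _ "dep_minus G H R"] exI[of _ "dep_plus G H R"])
      (auto simp: dep_minus_def dep_plus_def)
  show "Open_hom G H R = f"
  proof (rule extensionalityI[of _ "opens G"])
    fix Y assume "Y \<in> opens G"
    then obtain X where X: "X \<subseteq> src G" "Y = hf_set (rel G `` X)"
      by (rule opensE)
    have "f Y \<in> opens H"
      using jsl_hom_closed[OF f] \<open>Y \<in> opens G\<close> by simp
    then have "f Y = hf_set (R `` X)"
      using hf_set_elts_open[OF H] f_open[OF X(1)] X(2) by metis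
    then show "Open_hom G H R Y = f Y"
      using Open_hom_open[OF G hom] X(2) by simp
  qed (use jsl_hom_ext[OF f] in \<open>simp_all add: Open_hom_def\<close>)
qed

section \<open>Representation of a semilattice by its irreducibles\<close>

text \<open>The components of \<open>rep\<close> depend only on the semilattice; this version allows
  their study without an automaton.\<close>

definition rep_jsl :: "'x hf gorder \<Rightarrow> 'x hf \<Rightarrow> 'x hf" where
  "rep_jsl S = (\<lambda>x \<in> carrier S. hf_set {m \<in> meet_irr S. \<not> x \<sqsubseteq>\<^bsub>S\<^esub> m})"

lemma rep_eq_rep_jsl: "rep A = rep_jsl (jsl A)"
  by (simp add: rep_def rep_jsl_def)

lemma src_Pirr [simp]: "src (Pirr_obj S) = join_irr S"
  and tgt_Pirr [simp]: "tgt (Pirr_obj S) = meet_irr S"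
  by (simp_all add: Pirr_obj_def)

lemma join_irr_carrier: "j \<in> join_irr S \<Longrightarrow> j \<in> carrier S"
  and meet_irr_carrier: "m \<in> meet_irr S \<Longrightarrow> m \<in> carrier S"
  by (simp_all add: join_irr_def meet_irr_def)

context finite_jsl
begin

lemma dep_obj_Pirr: "dep_obj (Pirr_obj L)"
  using finite_carrier
  by (auto simp: dep_obj_def Pirr_obj_def join_irr_def meet_irr_def)

text \<open>A meet-irreducible bounds all of \<open>X\<close> iff it bounds the join. So every open
  set of \<open>Pirr_obj L\<close> comes from an element of \<open>L\<close>.\<close>

lemma Pirr_image:
  assumes "X \<subseteq> join_irr L"
  shows "rel (Pirr_obj L) `` X = {m \<in> meet_irr L. \<not> \<Squnion>X \<sqsubseteq> m}"
proof -
  have "X \<subseteq> carrier L"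
    using assms by (auto intro: join_irr_carrier)
  then have "\<Squnion>X \<sqsubseteq> m \<longleftrightarrow> (\<forall>x\<in>X. x \<sqsubseteq> m)" if "m \<in> meet_irr L" for m
    using sup_le_iff[OF _ meet_irr_carrier[OF that]] by simp
  then show ?thesis
    using assms by (fastforce simp: Pirr_obj_def)
qed

lemma Pirr_image_below:
  assumes "x \<in> carrier L"
  shows "rel (Pirr_obj L) `` {j \<in> join_irr L. j \<sqsubseteq> x} = {m \<in> meet_irr L. \<not> x \<sqsubseteq> m}"
  using Pirr_image[of "{j \<in> join_irr L. j \<sqsubseteq> x}"] sup_join_irr_below[OF assms] by auto

lemma finite_meet_irr: "finite (meet_irr L)"
  using dep_obj_Pirr by (simp add: dep_obj_def)

lemma meet_irr_separates_iff:
  assumes "x \<in> carrier L" "y \<in> carrier L"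
  shows "(\<exists>m \<in> meet_irr L. y \<sqsubseteq> m \<and> \<not> x \<sqsubseteq> m) \<longleftrightarrow> \<not> x \<sqsubseteq> y"
proof
  assume "\<not> x \<sqsubseteq> y"
  then show "\<exists>m \<in> meet_irr L. y \<sqsubseteq> m \<and> \<not> x \<sqsubseteq> m"
    using meet_irr_separates[OF assms] by metis
next
  assume "\<exists>m \<in> meet_irr L. y \<sqsubseteq> m \<and> \<not> x \<sqsubseteq> m"
  then show "\<not> x \<sqsubseteq> y"
    using le_trans assms meet_irr_carrier by metis
qed

end

text \<open>A suitable \<open>m\<close> exists by separation. With \<open>x\<close> the largest
  rejecting state this yields the lower final states of \<open>Airr\<close>.\<close>

lemma Pirr_converse_image_above:
  assumes "finite_jsl S" "x \<in> carrier S"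
  shows "(rel (Pirr_obj S))\<inverse> `` {m \<in> meet_irr S. x \<sqsubseteq>\<^bsub>S\<^esub> m} = {j \<in> join_irr S. \<not> j \<sqsubseteq>\<^bsub>S\<^esub> x}"
proof -
  have "(rel (Pirr_obj S))\<inverse> `` {m \<in> meet_irr S. x \<sqsubseteq>\<^bsub>S\<^esub> m}
      = {j \<in> join_irr S. \<exists>m \<in> meet_irr S. x \<sqsubseteq>\<^bsub>S\<^esub> m \<and> \<not> j \<sqsubseteq>\<^bsub>S\<^esub> m}"
    by (auto simp: Pirr_obj_def)
  then show ?thesis
    using finite_jsl.meet_irr_separates_iff[OF assms(1) join_irr_carrier assms(2)] by auto
qed

lemma elts_rep_jsl:
  "\<lbrakk>finite_jsl S; x \<in> carrier S\<rbrakk> \<Longrightarrow> elts (rep_jsl S x) = {m \<in> meet_irr S. \<not> x \<sqsubseteq>\<^bsub>S\<^esub> m}"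
  using finite_jsl.finite_meet_irr[of S] by (simp add: rep_jsl_def elts_hf_set)

lemma rep_jsl_open:
  assumes "finite_jsl S" "x \<in> carrier S"
  shows "rep_jsl S x = hf_set (rel (Pirr_obj S) `` {j \<in> join_irr S. j \<sqsubseteq>\<^bsub>S\<^esub> x})"
  using assms by (simp add: finite_jsl.Pirr_image_below rep_jsl_def)

lemma rep_jsl_join_irr:
  assumes "finite_jsl S" "j \<in> join_irr S"
  shows "rep_jsl S j = hf_set (rel (Pirr_obj S) `` {j})"
proof -
  have "rel (Pirr_obj S) `` {j} = {m \<in> meet_irr S. \<not> j \<sqsubseteq>\<^bsub>S\<^esub> m}"
    using assms(2) by (auto simp: Pirr_obj_def)
  then show ?thesis
    using join_irr_carrier[OF assms(2)] by (simp add: rep_jsl_def)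
qed

lemma rep_jsl_in_opens:
  "\<lbrakk>finite_jsl S; x \<in> carrier S\<rbrakk> \<Longrightarrow> rep_jsl S x \<in> opens (Pirr_obj S)"
  by (simp add: rep_jsl_open finite_jsl.dep_obj_Pirr open_in_opens)

text \<open>A meet-irreducible fails to bound a join iff it fails to bound some member, so joins
  become unions.\<close>

lemma rep_jsl_hom:
  assumes "finite_jsl S"
  shows "rep_jsl S \<in> jsl_hom S (Open_obj (Pirr_obj S))"
proof -
  note dep_obj_Pirr = finite_jsl.dep_obj_Pirr[OF assms]
  have "rep_jsl S (\<Squnion>\<^bsub>S\<^esub> A) = \<Squnion>\<^bsub>Open_obj (Pirr_obj S)\<^esub> (rep_jsl S ` A)" if A: "A \<subseteq> carrier S" for A
  proof -
    have sub: "rep_jsl S ` A \<subseteq> opens (Pirr_obj S)"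
      using rep_jsl_in_opens[OF assms] A by blast
    have "\<Union>(elts ` rep_jsl S ` A) = (\<Union>x\<in>A. {m \<in> meet_irr S. \<not> x \<sqsubseteq>\<^bsub>S\<^esub> m})"
      using A elts_rep_jsl[OF assms] by (auto simp: subset_iff)
    also have "\<dots> = {m \<in> meet_irr S. \<not> \<Squnion>\<^bsub>S\<^esub> A \<sqsubseteq>\<^bsub>S\<^esub> m}"
      using finite_jsl.sup_le_iff[OF assms A meet_irr_carrier] by auto
    finally show ?thesis
      using sup_Open[OF dep_obj_Pirr sub] finite_jsl.sup_closed[OF assms A] by (simp add: rep_jsl_def)
  qed
  then show ?thesis
    using rep_jsl_in_opens[OF assms] by (simp add: jsl_hom_def PiE_iff rep_jsl_def[of S])
qed

text \<open>Separation by meet-irreducibles gives injectivity; an open set generated by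
  \<open>X\<close> is the value at the join of \<open>X\<close>.\<close>

lemma rep_jsl_bij:
  assumes "finite_jsl S"
  shows "bij_betw (rep_jsl S) (carrier S) (opens (Pirr_obj S))"
proof -
  have le: "x \<sqsubseteq>\<^bsub>S\<^esub> y" if "x \<in> carrier S" "y \<in> carrier S" "rep_jsl S x = rep_jsl S y" for x y
  proof -
    have "{m \<in> meet_irr S. \<not> x \<sqsubseteq>\<^bsub>S\<^esub> m} = {m \<in> meet_irr S. \<not> y \<sqsubseteq>\<^bsub>S\<^esub> m}"
      using elts_rep_jsl[OF assms that(1)] elts_rep_jsl[OF assms that(2)] that(3) by simp
    then show ?thesis
      using finite_jsl.meet_irr_separates_iff[OF assms that(1,2)] by auto
  qed
  have "inj_on (rep_jsl S) (carrier S)"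
  proof (rule inj_onI)
    interpret finite_jsl S by (rule assms)
    show "x = y" if "x \<in> carrier S" "y \<in> carrier S" "rep_jsl S x = rep_jsl S y" for x y
      by (rule le_antisym) (simp_all add: le that)
  qed
  moreover have "rep_jsl S ` carrier S = opens (Pirr_obj S)"
  proof (intro equalityI subsetI)
    fix Y assume "Y \<in> opens (Pirr_obj S)"
    then obtain X where X: "X \<subseteq> join_irr S" "Y = hf_set (rel (Pirr_obj S) `` X)"
      by (auto elim: opensE)
    have "\<Squnion>\<^bsub>S\<^esub> X \<in> carrier S"
      using X(1) by (intro finite_jsl.sup_closed[OF assms]) (auto intro: join_irr_carrier)
    then have "rep_jsl S (\<Squnion>\<^bsub>S\<^esub> X) = Y" "\<Squnion>\<^bsub>S\<^esub> X \<in> carrier S"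
      using X finite_jsl.Pirr_image[OF assms] by (simp_all add: rep_jsl_def)
    then show "Y \<in> rep_jsl S ` carrier S"
      by blast
  qed (use rep_jsl_in_opens[OF assms] in blast)
  ultimately show ?thesis
    by (simp add: bij_betw_def)
qed

lemma Pirr_hom_image:
  assumes "finite_jsl T" "f \<in> jsl_hom S T" "j \<in> join_irr S"
  shows "hf_set (Pirr_hom S T f `` {j}) = rep_jsl T (f j)"
proof -
  have "Pirr_hom S T f `` {j} = {m \<in> meet_irr T. \<not> f j \<sqsubseteq>\<^bsub>T\<^esub> m}"
    using assms(3) by (auto simp: Pirr_hom_def)
  then show ?thesis
    using jsl_hom_closed[OF assms(2) join_irr_carrier[OF assms(3)]] by (simp add: rep_jsl_def)
qed

lemma Pirr_hom_subset: "Pirr_hom S T f \<subseteq> src (Pirr_obj S) \<times> tgt (Pirr_obj T)"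
  by (auto simp: Pirr_hom_def)

text \<open>Both claims come from the conjugate \<open>g\<close> of \<open>f\<close> by the
  representation. The generating open sets are the values of \<open>rep_jsl S\<close> at
  join-irreducibles \<open>j\<close>, where \<open>g\<close> returns \<open>rep_jsl T (f j)\<close>,
  the encoded image of \<open>j\<close> under \<open>Pirr_hom\<close>.\<close>

lemma Pirr_hom:
  assumes S: "finite_jsl S" and T: "finite_jsl T" and f: "f \<in> jsl_hom S T"
  shows "Pirr_hom S T f \<in> dep_hom (Pirr_obj S) (Pirr_obj T)"
    and "x \<in> carrier S \<Longrightarrow>
      Open_hom (Pirr_obj S) (Pirr_obj T) (Pirr_hom S T f) (rep_jsl S x) = rep_jsl T (f x)"
proof -
  let ?P = "Pirr_obj S" and ?Q = "Pirr_obj T"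
  define i where "i = restrict (inv_into (carrier S) (rep_jsl S)) (opens ?P)"
  define g where "g = compose (opens ?P) (rep_jsl T) (compose (opens ?P) f i)"
  note P = finite_jsl.dep_obj_Pirr[OF S] and Q = finite_jsl.dep_obj_Pirr[OF T]
  note finP = finite_jsl_Open[OF P]
  have "i \<in> jsl_hom (Open_obj ?P) S"
    unfolding i_def
    using jsl_hom_inv_into[OF S finP rep_jsl_hom[OF S]] rep_jsl_bij[OF S] by simp
  then have "compose (opens ?P) f i \<in> jsl_hom (Open_obj ?P) T"
    using jsl_hom_compose[OF finP _ f] by simp
  then have g: "g \<in> jsl_hom (Open_obj ?P) (Open_obj ?Q)"
    unfolding g_def using jsl_hom_compose[OF finP _ rep_jsl_hom[OF T]] by simp
  have g_rep: "g (rep_jsl S x) = rep_jsl T (f x)" if "x \<in> carrier S" for x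
    using that bij_betw_imp_inj_on[OF rep_jsl_bij[OF S]] rep_jsl_in_opens[OF S that]
    by (simp add: g_def i_def compose_eq)
  have "g (hf_set (rel ?P `` {j})) = hf_set (Pirr_hom S T f `` {j})" if "j \<in> src ?P" for j
    using that g_rep[of j] by (simp add: Pirr_hom_image[OF T f] rep_jsl_join_irr[OF S, symmetric] join_irr_carrier)
  note R = dep_hom_of_jsl_hom[OF P Q g Pirr_hom_subset this]
  show "Pirr_hom S T f \<in> dep_hom ?P ?Q"
    by (rule R(1))
  show "Open_hom ?P ?Q (Pirr_hom S T f) (rep_jsl S x) = rep_jsl T (f x)" if "x \<in> carrier S"
    using R(2) g_rep[OF that] by simp
qed

section \<open>Automata\<close>

lemma dfa_JSL_simps [simp]:
  "Obj dfa_JSL = {A. jsl_dfa A}" "Hom dfa_JSL = jsl_dfa_hom"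
  "Ident dfa_JSL A = restrict id (carrier (jsl A))"
  "Comp dfa_JSL A B D f g = compose (carrier (jsl A)) g f"
  by (simp_all add: dfa_JSL_def)

lemma aut_Dep_simps [simp]:
  "Obj aut_Dep = {A. dep_aut A}" "Hom aut_Dep = dep_aut_hom"
  "Ident aut_Dep A = rel (base A)"
  "Comp aut_Dep A B D R S = dep_comp (base A) (base B) R S"
  by (simp_all add: aut_Dep_def)

section \<open>The category of semilattice automata\<close>

lemma jsl_dfa_hom_iff:
  "f \<in> jsl_dfa_hom A B \<longleftrightarrow> f \<in> jsl_hom (jsl A) (jsl B) \<and> f (start A) = start B \<and>
     (\<forall>a. \<forall>s \<in> carrier (jsl A). f (delta A a s) = delta B a (f s)) \<and>
     {s \<in> carrier (jsl A). f s \<in> accept B} = accept A"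
  by (simp add: jsl_dfa_hom_def)

lemma jsl_dfa_hom_closed:
  "\<lbrakk>f \<in> jsl_dfa_hom A B; s \<in> carrier (jsl A)\<rbrakk> \<Longrightarrow> f s \<in> carrier (jsl B)"
  unfolding jsl_dfa_hom_iff by (blast dest: jsl_hom_closed)

lemma delta_closed: "\<lbrakk>jsl_dfa A; s \<in> carrier (jsl A)\<rbrakk> \<Longrightarrow> delta A a s \<in> carrier (jsl A)"
  unfolding jsl_dfa_def by (blast dest: jsl_hom_closed)

lemma accept_subset: "jsl_dfa A \<Longrightarrow> accept A \<subseteq> carrier (jsl A)"
  unfolding jsl_dfa_def by blast

lemma category_dfa_JSL: "category dfa_JSL"
proof
  fix A :: "('a, 'b) jsl_dfa" assume "A \<in> Obj dfa_JSL"
  then have A: "jsl_dfa A"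
    by simp
  then show "Ident dfa_JSL A \<in> Hom dfa_JSL A A"
    using accept_subset[OF A] delta_closed[OF A] jsl_hom_id[of "jsl A"]
    by (auto simp: jsl_dfa_hom_iff jsl_dfa_def)
next
  fix A B D :: "('a, 'b) jsl_dfa" and f g
  assume "A \<in> Obj dfa_JSL" "f \<in> Hom dfa_JSL A B" "g \<in> Hom dfa_JSL B D"
  then have A: "jsl_dfa A" and f: "f \<in> jsl_dfa_hom A B" and g: "g \<in> jsl_dfa_hom B D"
    by simp_all
  have "compose (carrier (jsl A)) g f \<in> jsl_hom (jsl A) (jsl D)"
    using A f g by (auto simp: jsl_dfa_hom_iff jsl_dfa_def intro: jsl_hom_compose)
  moreover have "compose (carrier (jsl A)) g f (start A) = start D"
    using A f g by (auto simp: jsl_dfa_hom_iff jsl_dfa_def compose_eq)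
  moreover have "compose (carrier (jsl A)) g f (delta A a s)
      = delta D a (compose (carrier (jsl A)) g f s)" if "s \<in> carrier (jsl A)" for a s
    using that f g delta_closed[OF A that] jsl_dfa_hom_closed[OF f that]
    by (simp add: jsl_dfa_hom_iff compose_eq)
  moreover have "{s \<in> carrier (jsl A). compose (carrier (jsl A)) g f s \<in> accept D} = accept A"
  proof -
    have "f s \<in> accept B \<longleftrightarrow> g (f s) \<in> accept D" if "s \<in> carrier (jsl A)" for s
      using g jsl_dfa_hom_closed[OF f that] unfolding jsl_dfa_hom_iff by blast
    then show ?thesis
      using f by (auto simp: jsl_dfa_hom_iff compose_def)
  qed
  ultimately show "Comp dfa_JSL A B D f g \<in> Hom dfa_JSL A D"
    by (simp add: jsl_dfa_hom_iff)
next
  fix A B :: "('a, 'b) jsl_dfa" and f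
  assume "f \<in> Hom dfa_JSL A B"
  then have "f \<in> carrier (jsl A) \<rightarrow> carrier (jsl B)" "f \<in> extensional (carrier (jsl A))"
    by (auto simp: jsl_dfa_hom_iff dest: jsl_hom_closed jsl_hom_ext)
  then show "Comp dfa_JSL A A B (Ident dfa_JSL A) f = f" "Comp dfa_JSL A B B f (Ident dfa_JSL B) = f"
    by (simp_all add: id_def Id_compose compose_Id)
next
  fix A B D E :: "('a, 'b) jsl_dfa" and f g h
  assume "f \<in> Hom dfa_JSL A B"
  then have "f \<in> carrier (jsl A) \<rightarrow> carrier (jsl B)"
    by (auto dest: jsl_dfa_hom_closed)
  then show "Comp dfa_JSL A D E (Comp dfa_JSL A B D f g) h = Comp dfa_JSL A B E f (Comp dfa_JSL B D E g h)"
    by (simp add: compose_assoc)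
qed

text \<open>Each condition on the inverse function is the one on \<open>f\<close> read at a
  preimage, after which \<open>f\<close> is cancelled.\<close>

lemma is_iso_dfa_JSL:
  assumes A: "jsl_dfa A" and B: "jsl_dfa B" and f: "f \<in> jsl_dfa_hom A B"
    and bij: "bij_betw f (carrier (jsl A)) (carrier (jsl B))"
  shows "is_iso dfa_JSL A B f"
proof -
  let ?g = "restrict (inv_into (carrier (jsl A)) f) (carrier (jsl B))"
  have fg: "?g t \<in> carrier (jsl A)" "f (?g t) = t" if "t \<in> carrier (jsl B)" for t
    using bij that by (auto simp: bij_betw_def inv_into_into f_inv_into_f)
  have gf: "?g (f s) = s" if "s \<in> carrier (jsl A)" for s
    using bij that jsl_dfa_hom_closed[OF f that] by (simp add: bij_betw_def)
  have "?g \<in> jsl_hom (jsl B) (jsl A)"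
    using A B f bij by (intro jsl_hom_inv_into) (auto simp: jsl_dfa_def jsl_dfa_hom_iff)
  moreover have "?g (start B) = start A"
  proof -
    have "start A \<in> carrier (jsl A)" "f (start A) = start B"
      using A f by (simp_all add: jsl_dfa_def jsl_dfa_hom_iff)
    then show ?thesis
      using gf by metis
  qed
  moreover have "?g (delta B a t) = delta A a (?g t)" if "t \<in> carrier (jsl B)" for a t
  proof -
    have "f (delta A a (?g t)) = delta B a (f (?g t))"
      using f fg(1)[OF that] unfolding jsl_dfa_hom_iff by blast
    then show ?thesis
      using gf[OF delta_closed[OF A fg(1)[OF that]]] fg(2)[OF that] by metis
  qed
  moreover have "{t \<in> carrier (jsl B). ?g t \<in> accept A} = accept B"
  proof -
    have "?g t \<in> accept A \<longleftrightarrow> f (?g t) \<in> accept B" if "t \<in> carrier (jsl B)" for t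
      using f fg(1)[OF that] unfolding jsl_dfa_hom_iff by blast
    then show ?thesis
      using accept_subset[OF B] fg(2) by auto
  qed
  ultimately have "?g \<in> jsl_dfa_hom B A"
    by (simp add: jsl_dfa_hom_iff)
  moreover have "compose (carrier (jsl A)) ?g f = restrict id (carrier (jsl A))"
    using gf by (simp add: compose_def cong: restrict_cong)
  moreover have "compose (carrier (jsl B)) f ?g = restrict id (carrier (jsl B))"
    using fg(2) by (simp add: compose_def cong: restrict_cong)
  ultimately show ?thesis
    using f unfolding is_iso_def by auto
qed

section \<open>Dependency automata and \<open>Det\<close>\<close>

lemma dep_autD:
  assumes "dep_aut A"
  shows "dep_obj (base A)"
    and "step (lower A) a \<subseteq> src (base A) \<times> src (base A)"
    and "step (upper A) a \<subseteq> tgt (base A) \<times> tgt (base A)"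
    and "init (lower A) \<subseteq> src (base A)"
    and "step (lower A) a O rel (base A) = rel (base A) O (step (upper A) a)\<inverse>"
    and "final (upper A) = rel (base A) `` init (lower A)"
    and "final (lower A) = (rel (base A))\<inverse> `` init (upper A)"
proof -
  have nfas: "nfa (lower A)" "nfa (upper A)"
    and sts: "states (lower A) = src (base A)" "states (upper A) = tgt (base A)"
    using assms by (simp_all add: dep_aut_def Let_def)
  show "step (lower A) a \<subseteq> src (base A) \<times> src (base A)" "init (lower A) \<subseteq> src (base A)"
    using nfas(1) unfolding nfa_def sts by simp_all
  show "step (upper A) a \<subseteq> tgt (base A) \<times> tgt (base A)"
    using nfas(2) unfolding nfa_def sts by simp
qed (use assms in \<open>simp_all add: dep_aut_def Let_def\<close>)

text \<open>The commutation law turns a backward upper step on \<open>G[X]\<close> into a lower step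
  on \<open>X\<close>. In particular the transitions of \<open>Det\<close> keep sets open.\<close>

lemma step_image:
  assumes "dep_aut A"
  shows "(step (upper A) a)\<inverse> `` (rel (base A) `` X) = rel (base A) `` (step (lower A) a `` X)"
  using dep_autD(5)[OF assms] relcomp_Image by metis

lemma Det_simps [simp]:
  "start (on_obj Det A) = hf_set (final (upper A))"
  "jsl (on_obj Det A) = Open_obj (base A)"
  "delta (on_obj Det A) a = (\<lambda>Y \<in> opens (base A). hf_set ((step (upper A) a)\<inverse> `` elts Y))"
  "accept (on_obj Det A) = {Y \<in> opens (base A). elts Y \<inter> init (upper A) \<noteq> {}}"
  "on_hom Det A B R = Open_hom (base A) (base B) R"
  by (simp_all add: Det_def)

lemma delta_Det_open:
  assumes "dep_aut A"
  shows "delta (on_obj Det A) a (hf_set (rel (base A) `` X)) =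
    hf_set (rel (base A) `` (step (lower A) a `` X))"
  using dep_autD(1)[OF assms] by (simp add: open_in_opens elts_open step_image[OF assms])

lemma jsl_dfa_Det:
  assumes A: "dep_aut A"
  shows "jsl_dfa (on_obj Det A)"
proof -
  let ?G = "base A"
  note G = dep_autD(1)[OF A]
  have "delta (on_obj Det A) a \<in> jsl_hom (Open_obj ?G) (Open_obj ?G)" for a
    unfolding Det_simps
  proof (rule image_jsl_hom[OF G G])
    show "(step (upper A) a)\<inverse> \<subseteq> tgt ?G \<times> tgt ?G"
      using dep_autD(3)[OF A, of a] by blast
    show "\<exists>X'. (step (upper A) a)\<inverse> `` (rel ?G `` X) = rel ?G `` X'" for X
      using step_image[OF A] by metis
  qed
  moreover
  \<comment> \<open>The union \<open>t\<close> of all open sets missing the initial states of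
    \<open>upper A\<close> misses them too, so the rejecting states are exactly those below
    \<open>t\<close>.\<close>
  define D where "D = {Y \<in> opens ?G. elts Y \<inter> init (upper A) = {}}"
  define t where "t = hf_set (\<Union>(elts ` D))"
  have "D \<subseteq> opens ?G"
    by (auto simp: D_def)
  then have t: "t \<in> opens ?G" "elts t = \<Union>(elts ` D)"
    unfolding t_def by (rule Union_open[OF G])+
  have "elts Y \<inter> init (upper A) \<noteq> {} \<longleftrightarrow> \<not> elts Y \<subseteq> elts t" if "Y \<in> opens ?G" for Y
    using that unfolding t(2) D_def by blast
  then have "accept (on_obj Det A) = {Y \<in> opens ?G. \<not> Y \<sqsubseteq>\<^bsub>Open_obj ?G\<^esub> t}"
    using t(1) by auto
  ultimately show ?thesis
    unfolding jsl_dfa_def Det_simps(2) carrier_Open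
    using finite_jsl_Open[OF G] t(1) dep_autD(6)[OF A] open_in_opens[OF G] by auto
qed

lemma dep_aut_homD:
  assumes "R \<in> dep_aut_hom A B"
  shows "R \<in> dep_hom (base A) (base B)"
    and "step (lower A) a O R = R O (step (upper B) a)\<inverse>"
    and "R `` init (lower A) = final (upper B)"
    and "R\<inverse> `` init (upper B) = final (lower A)"
  using assms by (simp_all add: dep_aut_hom_def)

text \<open>The map sends an open set \<open>G[X]\<close> to \<open>R[X]\<close>, so each condition
  on it reduces to the corresponding equation for \<open>R\<close>.\<close>

lemma Open_hom_dfa_hom:
  assumes A: "dep_aut A" and B: "dep_aut B" and R: "R \<in> dep_aut_hom A B"
  shows "Open_hom (base A) (base B) R \<in> jsl_dfa_hom (on_obj Det A) (on_obj Det B)"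
proof -
  let ?f = "Open_hom (base A) (base B) R"
  note G = dep_autD(1)[OF A] and H = dep_autD(1)[OF B] and hom = dep_aut_homD(1)[OF R]
  note f_open = Open_hom_open[OF G hom] and img = dep_hom_image_open[OF H hom]
  have "?f (start (on_obj Det A)) = start (on_obj Det B)"
    using f_open[of "init (lower A)"] by (simp add: dep_autD(6)[OF A] dep_aut_homD(3)[OF R])
  moreover have "?f (delta (on_obj Det A) a Y) = delta (on_obj Det B) a (?f Y)"
    if Y: "Y \<in> opens (base A)" for a Y
  proof -
    obtain X where X: "Y = hf_set (rel (base A) `` X)"
      using Y by (rule opensE)
    have "R `` (step (lower A) a `` X) = (step (upper B) a)\<inverse> `` (R `` X)"
      using dep_aut_homD(2)[OF R, of a] relcomp_Image by metis
    then show ?thesis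
      unfolding X delta_Det_open[OF A] f_open by (simp add: img)
  qed
  moreover have "{Y \<in> opens (base A). ?f Y \<in> accept (on_obj Det B)} = accept (on_obj Det A)"
  proof -
    have "?f Y \<in> accept (on_obj Det B) \<longleftrightarrow> elts Y \<inter> init (upper A) \<noteq> {}"
      if Y: "Y \<in> opens (base A)" for Y
    proof -
      obtain X where X: "Y = hf_set (rel (base A) `` X)"
        using Y by (rule opensE)
      \<comment> \<open>\<open>final (lower A)\<close> is the preimage of
        \<open>init (upper B)\<close> under \<open>R\<close> and of \<open>init (upper A)\<close>
        under \<open>rel (base A)\<close>; both acceptance conditions ask whether \<open>X\<close>
        meets it.\<close>
      have "?f Y \<in> accept (on_obj Det B) \<longleftrightarrow> X \<inter> R\<inverse> `` init (upper B) \<noteq> {}"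
        unfolding X f_open Det_simps by (simp add: img) blast
      also have "\<dots> \<longleftrightarrow> X \<inter> (rel (base A))\<inverse> `` init (upper A) \<noteq> {}"
        by (simp only: dep_aut_homD(4)[OF R] dep_autD(7)[OF A])
      also have "\<dots> \<longleftrightarrow> elts Y \<inter> init (upper A) \<noteq> {}"
        unfolding X elts_open[OF G] by blast
      finally show ?thesis .
    qed
    then show ?thesis
      by auto
  qed
  ultimately show ?thesis
    unfolding jsl_dfa_hom_iff Det_simps(2) carrier_Open
    using Open_hom_jsl_hom[OF G H hom] by blast
qed

lemma rel_eqI: "(\<And>x. R `` {x} = S `` {x}) \<Longrightarrow> R = S"
  by (auto simp: set_eq_iff)

text \<open>The conditions on \<open>f\<close>, evaluated at the start state and at the generators
  \<open>G[{g}]\<close>, become the equations for \<open>R\<close>. This criterion serves for the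
  fullness of \<open>Det\<close>, for identities and composites in \<open>aut_Dep\<close>, for
  \<open>Pirr_hom\<close> and for \<open>red\<close>.\<close>

lemma dep_aut_hom_of_dfa_hom:
  assumes A: "dep_aut A" and B: "dep_aut B"
    and f: "f \<in> jsl_dfa_hom (on_obj Det A) (on_obj Det B)"
    and R: "R \<subseteq> src (base A) \<times> tgt (base B)"
    and fR: "\<And>g. g \<in> src (base A) \<Longrightarrow> f (hf_set (rel (base A) `` {g})) = hf_set (R `` {g})"
  shows "R \<in> dep_aut_hom A B" "Open_hom (base A) (base B) R = f"
proof -
  note G = dep_autD(1)[OF A] and H = dep_autD(1)[OF B]
  have f': "f \<in> jsl_hom (Open_obj (base A)) (Open_obj (base B))"
    and f_start: "f (start (on_obj Det A)) = start (on_obj Det B)"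
    and f_delta: "\<And>a Y. Y \<in> opens (base A) \<Longrightarrow>
      f (delta (on_obj Det A) a Y) = delta (on_obj Det B) a (f Y)"
    and f_accept: "{Y \<in> opens (base A). f Y \<in> accept (on_obj Det B)} = accept (on_obj Det A)"
    using f unfolding jsl_dfa_hom_iff Det_simps(2) carrier_Open by blast+
  note hom = dep_hom_of_jsl_hom[OF G H f' R fR]
  show "Open_hom (base A) (base B) R = f"
    by (rule hom(2))
  have f_open: "f (hf_set (rel (base A) `` X)) = hf_set (R `` X)" for X
    using Open_hom_open[OF G hom(1)] hom(2) by simp
  note img = dep_hom_image_open[OF H hom(1)]
  have "R `` (step (lower A) a `` {g}) = (step (upper B) a)\<inverse> `` (R `` {g})" for a g
  proof -
    have "hf_set (R `` (step (lower A) a `` {g}))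
        = f (delta (on_obj Det A) a (hf_set (rel (base A) `` {g})))"
      by (simp only: delta_Det_open[OF A] f_open)
    also have "\<dots> = delta (on_obj Det B) a (hf_set (R `` {g}))"
      by (simp only: f_delta open_in_opens[OF G] f_open)
    also have "\<dots> = hf_set ((step (upper B) a)\<inverse> `` (R `` {g}))"
      by (simp add: img)
    finally have "elts (hf_set (R `` (step (lower A) a `` {g})))
        = elts (hf_set ((step (upper B) a)\<inverse> `` (R `` {g})))"
      by simp
    \<comment> \<open>\<open>elts\<close> is known to invert \<open>hf_set\<close> on finite sets
      only, so decoding this side needs finiteness.\<close>
    moreover have "finite ((step (upper B) a)\<inverse> `` (R `` {g}))"
    proof (rule finite_subset)
      show "(step (upper B) a)\<inverse> `` (R `` {g}) \<subseteq> tgt (base B)"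
        using dep_autD(3)[OF B, of a] by blast
      show "finite (tgt (base B))"
        using H by (simp add: dep_obj_def)
    qed
    ultimately show ?thesis
      by (simp add: img elts_hf_set)
  qed
  then have "step (lower A) a O R = R O (step (upper B) a)\<inverse>" for a
    by (intro rel_eqI) (simp add: relcomp_Image)
  moreover have "R `` init (lower A) = final (upper B)"
  proof -
    have "hf_set (R `` init (lower A)) = hf_set (final (upper B))"
      using f_start f_open[of "init (lower A)"] by (simp add: dep_autD(6)[OF A])
    then show ?thesis
      using img(2) elts_open[OF H] dep_autD(6)[OF B] by metis
  qed
  moreover have "R\<inverse> `` init (upper B) = final (lower A)"
  proof -
    \<comment> \<open>The preimage consists of those \<open>g\<close> for which
      \<open>R[{g}]\<close>, the value of \<open>f\<close> at \<open>G[{g}]\<close>, is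
      accepting.\<close>
    have "g \<in> R\<inverse> `` init (upper B) \<longleftrightarrow> g \<in> (rel (base A))\<inverse> `` init (upper A)" for g
    proof -
      have "g \<in> R\<inverse> `` init (upper B) \<longleftrightarrow> f (hf_set (rel (base A) `` {g})) \<in> accept (on_obj Det B)"
        unfolding f_open Det_simps by (simp add: img) blast
      also have "\<dots> \<longleftrightarrow> hf_set (rel (base A) `` {g}) \<in> accept (on_obj Det A)"
        using f_accept open_in_opens[OF G] by blast
      also have "\<dots> \<longleftrightarrow> g \<in> (rel (base A))\<inverse> `` init (upper A)"
        unfolding Det_simps by (simp add: elts_open[OF G] open_in_opens[OF G]) blast
      finally show ?thesis .
    qed
    then show ?thesis
      unfolding dep_autD(7)[OF A] by blast
  qed
  ultimately show "R \<in> dep_aut_hom A B"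
    using hom(1) by (simp add: dep_aut_hom_def)
qed

text \<open>\<open>R[{g}]\<close> can be read off from the value of the induced map at
  \<open>G[{g}]\<close>.\<close>

lemma Open_hom_inj:
  assumes A: "dep_aut A" and B: "dep_aut B"
    and R: "R \<in> dep_aut_hom A B" and R': "R' \<in> dep_aut_hom A B"
    and eq: "Open_hom (base A) (base B) R = Open_hom (base A) (base B) R'"
  shows "R = R'"
proof -
  note G = dep_autD(1)[OF A] and H = dep_autD(1)[OF B]
  note hom = dep_aut_homD(1)[OF R] and hom' = dep_aut_homD(1)[OF R']
  have "R `` {g} = R' `` {g}" for g
    using eq Open_hom_open[OF G hom, of "{g}"] Open_hom_open[OF G hom', of "{g}"]
      dep_hom_image_open(2)[OF H hom, of "{g}"] dep_hom_image_open(2)[OF H hom', of "{g}"] by simp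
  then show ?thesis
    by (rule rel_eqI)
qed

lemma category_embedding_Det: "category_embedding aut_Dep dfa_JSL Det"
proof -
  interpret D: category dfa_JSL
    by (rule category_dfa_JSL)
  show ?thesis
  proof
    show "on_obj Det A \<in> Obj dfa_JSL" if "A \<in> Obj aut_Dep" for A :: "('a, 'b hf) dep_aut"
      using that by (simp add: jsl_dfa_Det)
  next
    fix A B :: "('a, 'b hf) dep_aut"
    assume "A \<in> Obj aut_Dep" "B \<in> Obj aut_Dep"
    then have A: "dep_aut A" and B: "dep_aut B"
      by simp_all
    note G = dep_autD(1)[OF A] and H = dep_autD(1)[OF B]
    have "\<exists>R \<in> dep_aut_hom A B. f = Open_hom (base A) (base B) R"
      if f: "f \<in> jsl_dfa_hom (on_obj Det A) (on_obj Det B)" for f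
    proof -
      let ?R = "{(g, h). g \<in> src (base A) \<and> h \<in> elts (f (hf_set (rel (base A) `` {g})))}"
      have f_opens: "f (hf_set (rel (base A) `` {g})) \<in> opens (base B)" for g
        using jsl_dfa_hom_closed[OF f] open_in_opens[OF G] by simp
      then have sub: "?R \<subseteq> src (base A) \<times> tgt (base B)"
        using elts_open_subset[OF H] by blast
      have "f (hf_set (rel (base A) `` {g})) = hf_set (?R `` {g})" if "g \<in> src (base A)" for g
      proof -
        have "?R `` {g} = elts (f (hf_set (rel (base A) `` {g})))"
          using that by auto
        then show ?thesis
          using hf_set_elts_open[OF H f_opens] by simp
      qed
      note R = dep_aut_hom_of_dfa_hom[OF A B f sub this]
      show ?thesis
      proof (rule bexI[of _ ?R])
        show "f = Open_hom (base A) (base B) ?R"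
          by (rule R(2)[symmetric])
        show "?R \<in> dep_aut_hom A B"
          by (rule R(1))
      qed
    qed
    then have "Open_hom (base A) (base B) ` dep_aut_hom A B = jsl_dfa_hom (on_obj Det A) (on_obj Det B)"
      using Open_hom_dfa_hom[OF A B] by (intro equalityI subsetI) (metis imageE, metis imageI)
    moreover have "inj_on (Open_hom (base A) (base B)) (dep_aut_hom A B)"
      using Open_hom_inj[OF A B] by (rule inj_onI)
    moreover have "on_hom Det A B = Open_hom (base A) (base B)"
      by (rule ext) simp
    ultimately show "bij_betw (on_hom Det A B) (Hom aut_Dep A B)
        (Hom dfa_JSL (on_obj Det A) (on_obj Det B))"
      unfolding bij_betw_def aut_Dep_simps dfa_JSL_simps by metis
  next
    fix A :: "('a, 'b hf) dep_aut"
    assume "A \<in> Obj aut_Dep"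
    then have A: "dep_aut A"
      by simp
    note G = dep_autD(1)[OF A]
    \<comment> \<open>The identity map is induced by \<open>rel (base A)\<close>, which gives
      closure under identities and their preservation together.\<close>
    have "restrict id (opens (base A)) \<in> jsl_dfa_hom (on_obj Det A) (on_obj Det A)"
      using D.Ident_in_Hom[of "on_obj Det A"] jsl_dfa_Det[OF A] by simp
    from dep_aut_hom_of_dfa_hom[OF A A this, of "rel (base A)"]
    show "Ident aut_Dep A \<in> Hom aut_Dep A A"
      and "on_hom Det A A (Ident aut_Dep A) = Ident dfa_JSL (on_obj Det A)"
      using G open_in_opens[OF G] by (simp_all add: dep_obj_def)
  next
    fix A B E :: "('a, 'b hf) dep_aut" and R S
    assume "A \<in> Obj aut_Dep" "B \<in> Obj aut_Dep" "E \<in> Obj aut_Dep"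
      "R \<in> Hom aut_Dep A B" "S \<in> Hom aut_Dep B E"
    then have A: "dep_aut A" and B: "dep_aut B" and E: "dep_aut E"
      and R: "R \<in> dep_aut_hom A B" and S: "S \<in> dep_aut_hom B E"
      by simp_all
    note G = dep_autD(1)[OF A] and H = dep_autD(1)[OF B]
    note homR = dep_aut_homD(1)[OF R] and homS = dep_aut_homD(1)[OF S]
    let ?h = "compose (opens (base A)) (Open_hom (base B) (base E) S) (Open_hom (base A) (base B) R)"
    have h: "?h \<in> jsl_dfa_hom (on_obj Det A) (on_obj Det E)"
      using D.Comp_in_Hom[of "on_obj Det A" "on_obj Det B" "on_obj Det E"
          "Open_hom (base A) (base B) R" "Open_hom (base B) (base E) S"]
        Open_hom_dfa_hom[OF A B R] Open_hom_dfa_hom[OF B E S] jsl_dfa_Det[OF A] jsl_dfa_Det[OF B]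
        jsl_dfa_Det[OF E] by simp
    have sub: "dep_comp (base A) (base B) R S \<subseteq> src (base A) \<times> tgt (base E)"
      using dep_hom_subset[OF homS] unfolding dep_comp_def dep_minus_def by blast
    \<comment> \<open>\<open>R[{g}]\<close> is the image under \<open>rel (base B)\<close> of the
      points that \<open>dep_minus\<close> relates to \<open>g\<close>; in this form
      \<open>Open_hom\<close> for \<open>S\<close> can be evaluated, giving the composite in
      Dep.\<close>
    have "?h (hf_set (rel (base A) `` {g})) = hf_set (dep_comp (base A) (base B) R S `` {g})" for g
    proof -
      have "?h (hf_set (rel (base A) `` {g}))
          = Open_hom (base B) (base E) S (hf_set (R `` {g}))"
        using open_in_opens[OF G] by (simp add: compose_eq Open_hom_open[OF G homR])
      also have "\<dots> = hf_set (S `` (dep_minus (base A) (base B) R `` {g}))"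
        unfolding image_minus[OF homR, symmetric] by (rule Open_hom_open[OF H homS])
      finally show ?thesis
        by (simp add: dep_comp_def relcomp_Image)
    qed
    from dep_aut_hom_of_dfa_hom[OF A E h sub this]
    show "Comp aut_Dep A B E R S \<in> Hom aut_Dep A E"
      and "on_hom Det A E (Comp aut_Dep A B E R S) =
        Comp dfa_JSL (on_obj Det A) (on_obj Det B) (on_obj Det E) (on_hom Det A B R) (on_hom Det B E S)"
      by simp_all
  qed
qed

section \<open>Automata of irreducibles\<close>

lemma Airr_simps [simp]:
  "base (on_obj Airr A) = Pirr_obj (jsl A)"
  "states (lower (on_obj Airr A)) = join_irr (jsl A)"
  "init (lower (on_obj Airr A)) = {j \<in> join_irr (jsl A). j \<sqsubseteq>\<^bsub>jsl A\<^esub> start A}"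
  "step (lower (on_obj Airr A)) a =
    dep_minus (Pirr_obj (jsl A)) (Pirr_obj (jsl A)) (Pirr_hom (jsl A) (jsl A) (delta A a))"
  "final (lower (on_obj Airr A)) = join_irr (jsl A) \<inter> accept A"
  "states (upper (on_obj Airr A)) = meet_irr (jsl A)"
  "init (upper (on_obj Airr A)) =
    {m \<in> meet_irr (jsl A). \<Squnion>\<^bsub>jsl A\<^esub> (carrier (jsl A) - accept A) \<sqsubseteq>\<^bsub>jsl A\<^esub> m}"
  "step (upper (on_obj Airr A)) a =
    dep_plus (Pirr_obj (jsl A)) (Pirr_obj (jsl A)) (Pirr_hom (jsl A) (jsl A) (delta A a))"
  "final (upper (on_obj Airr A)) = {m \<in> meet_irr (jsl A). \<not> start A \<sqsubseteq>\<^bsub>jsl A\<^esub> m}"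
  "on_hom Airr A B f = Pirr_hom (jsl A) (jsl B) f"
  by (simp_all add: Airr_def Let_def)

text \<open>The rejecting states are those below the element \<open>t\<close> defining acceptance,
  and \<open>t\<close> is one of them. So the join in \<open>Airr\<close> recovers
  \<open>t\<close>.\<close>

lemma accept_eq_not_le_sup:
  assumes "jsl_dfa A"
  shows "accept A = {s \<in> carrier (jsl A).
    \<not> s \<sqsubseteq>\<^bsub>jsl A\<^esub> \<Squnion>\<^bsub>jsl A\<^esub> (carrier (jsl A) - accept A)}"
proof -
  interpret finite_jsl "jsl A"
    using assms by (simp add: jsl_dfa_def)
  obtain t where t: "t \<in> carrier (jsl A)" "accept A = {s \<in> carrier (jsl A). \<not> s \<sqsubseteq>\<^bsub>jsl A\<^esub> t}"
    using assms by (auto simp: jsl_dfa_def)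
  have "\<Squnion>\<^bsub>jsl A\<^esub> (carrier (jsl A) - accept A) = t"
    by (rule sup_eqI) (simp_all add: t)
  then show ?thesis
    using t(2) by simp
qed

text \<open>The step relations are the two largest witnesses of one morphism, so their composites
  with \<open>Pirr_obj\<close> both equal \<open>Pirr_hom\<close>. Initial and final states match by
  separation.\<close>

lemma dep_aut_Airr:
  fixes A :: "('a, 'x hf) jsl_dfa"
  assumes A: "jsl_dfa A"
  shows "dep_aut (on_obj Airr A)"
proof -
  let ?P = "Pirr_obj (jsl A)"
  have S: "finite_jsl (jsl A)" and start: "start A \<in> carrier (jsl A)"
    and delta: "\<And>a. delta A a \<in> jsl_hom (jsl A) (jsl A)"
    using A by (simp_all add: jsl_dfa_def)
  note P = finite_jsl.dep_obj_Pirr[OF S] and hom = Pirr_hom(1)[OF S S delta]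
  have finite: "finite (join_irr (jsl A))" "finite (meet_irr (jsl A))"
    using P by (simp_all add: dep_obj_def)
  have sup: "\<Squnion>\<^bsub>jsl A\<^esub> (carrier (jsl A) - accept A) \<in> carrier (jsl A)"
    by (rule finite_jsl.sup_closed[OF S]) blast
  have "join_irr (jsl A) \<inter> accept A
      = {j \<in> join_irr (jsl A). \<not> j \<sqsubseteq>\<^bsub>jsl A\<^esub> \<Squnion>\<^bsub>jsl A\<^esub> (carrier (jsl A) - accept A)}"
    by (subst accept_eq_not_le_sup[OF A]) (auto dest: join_irr_carrier)
  then show ?thesis
    unfolding dep_aut_def nfa_def Let_def Airr_simps
    using P finite dep_hom_minus[OF hom] dep_hom_plus[OF hom]
      finite_jsl.Pirr_image_below[OF S start] Pirr_converse_image_above[OF S sup]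
    by (auto simp: dep_minus_def dep_plus_def)
qed

section \<open>The natural isomorphisms and \<open>Airr\<close> on morphisms\<close>

lemma rep_dfa_hom:
  fixes A :: "('a, 'x hf) jsl_dfa"
  assumes A: "jsl_dfa A"
  shows "rep A \<in> jsl_dfa_hom A (on_obj Det (on_obj Airr A))"
proof -
  let ?P = "Pirr_obj (jsl A)" and ?t = "\<Squnion>\<^bsub>jsl A\<^esub> (carrier (jsl A) - accept A)"
  have S: "finite_jsl (jsl A)" and start: "start A \<in> carrier (jsl A)"
    and delta: "\<And>a. delta A a \<in> jsl_hom (jsl A) (jsl A)"
    using A by (simp_all add: jsl_dfa_def)
  have t: "?t \<in> carrier (jsl A)"
    by (rule finite_jsl.sup_closed[OF S]) blast
  have "rep A (start A) = hf_set {m \<in> meet_irr (jsl A). \<not> start A \<sqsubseteq>\<^bsub>jsl A\<^esub> m}"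
    using start by (simp add: rep_def)
  \<comment> \<open>The transition on the right is \<open>Open_hom\<close> of
    \<open>Pirr_hom\<close> of \<open>delta A a\<close>, so this is naturality of the representation
    at \<open>delta A a\<close>.\<close>
  moreover have "rep A (delta A a s) = delta (on_obj Det (on_obj Airr A)) a (rep A s)"
    if "s \<in> carrier (jsl A)" for a s
    using Pirr_hom(2)[OF S S delta that] by (simp add: rep_eq_rep_jsl Open_hom_def)
  moreover have "{s \<in> carrier (jsl A). rep A s \<in> accept (on_obj Det (on_obj Airr A))} = accept A"
  proof -
    \<comment> \<open>The initial states of the upper part are the meet-irreducibles above
      \<open>?t\<close>; by separation one of them fails to bound \<open>s\<close> iff
      \<open>s\<close> is not below \<open>?t\<close>.\<close>
    have "rep A s \<in> accept (on_obj Det (on_obj Airr A)) \<longleftrightarrow> \<not> s \<sqsubseteq>\<^bsub>jsl A\<^esub> ?t"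
      if "s \<in> carrier (jsl A)" for s
      using finite_jsl.meet_irr_separates_iff[OF S that t]
      by (simp add: rep_eq_rep_jsl rep_jsl_in_opens[OF S that] elts_rep_jsl[OF S that]) blast
    then show ?thesis
      by (intro trans[OF _ accept_eq_not_le_sup[OF A, symmetric]]) auto
  qed
  ultimately show ?thesis
    using rep_jsl_hom[OF S] by (simp add: jsl_dfa_hom_iff rep_eq_rep_jsl)
qed

lemma rep_iso:
  fixes A :: "('a, 'x hf) jsl_dfa"
  assumes "jsl_dfa A"
  shows "is_iso dfa_JSL A (on_obj Det (on_obj Airr A)) (rep A)"
proof (rule is_iso_dfa_JSL[OF assms jsl_dfa_Det[OF dep_aut_Airr[OF assms]] rep_dfa_hom[OF assms]])
  have "finite_jsl (jsl A)"
    using assms by (simp add: jsl_dfa_def)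
  then show "bij_betw (rep A) (carrier (jsl A)) (carrier (jsl (on_obj Det (on_obj Airr A))))"
    using rep_jsl_bij by (simp add: rep_eq_rep_jsl)
qed

text \<open>The conjugate of \<open>f\<close> by \<open>rep\<close> is formed inside
  \<open>dfa_JSL\<close>, so it respects the automata structure; its values at the generators show
  that \<open>Pirr_hom\<close> induces it.\<close>

lemma Pirr_hom_dep_aut_hom:
  fixes A B :: "('a, 'x hf) jsl_dfa"
  assumes A: "jsl_dfa A" and B: "jsl_dfa B" and f: "f \<in> jsl_dfa_hom A B"
  shows "Pirr_hom (jsl A) (jsl B) f \<in> dep_aut_hom (on_obj Airr A) (on_obj Airr B)"
proof -
  interpret D: category dfa_JSL
    by (rule category_dfa_JSL)
  let ?X = "on_obj Det (on_obj Airr A)" and ?Y = "on_obj Det (on_obj Airr B)"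
  have S: "finite_jsl (jsl A)" and T: "finite_jsl (jsl B)" and f': "f \<in> jsl_hom (jsl A) (jsl B)"
    using A B f by (simp_all add: jsl_dfa_def jsl_dfa_hom_iff)
  have X: "jsl_dfa ?X" and Y: "jsl_dfa ?Y"
    using A B by (simp_all add: jsl_dfa_Det dep_aut_Airr)
  obtain i where i: "i \<in> jsl_dfa_hom ?X A"
    "compose (carrier (jsl A)) i (rep A) = restrict id (carrier (jsl A))"
    using rep_iso[OF A] unfolding is_iso_def by auto
  define g where "g = compose (opens (Pirr_obj (jsl A))) (rep B) (compose (opens (Pirr_obj (jsl A))) f i)"
  have "compose (opens (Pirr_obj (jsl A))) f i \<in> jsl_dfa_hom ?X B"
    using D.Comp_in_Hom[of ?X A B i f] X A B i f by simp
  then have g: "g \<in> jsl_dfa_hom ?X ?Y"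
    unfolding g_def using D.Comp_in_Hom[of ?X B ?Y _ "rep B"] X B Y rep_dfa_hom[OF B] by simp
  have "g (hf_set (rel (Pirr_obj (jsl A)) `` {j})) = hf_set (Pirr_hom (jsl A) (jsl B) f `` {j})"
    if "j \<in> join_irr (jsl A)" for j
  proof -
    note j = join_irr_carrier[OF that]
    have "i (rep A j) = j"
      using fun_cong[OF i(2), of j] j by (simp add: compose_eq)
    then have "g (rep_jsl (jsl A) j) = rep_jsl (jsl B) (f j)"
      using rep_jsl_in_opens[OF S j] by (simp add: g_def compose_eq rep_eq_rep_jsl)
    then show ?thesis
      by (simp add: Pirr_hom_image[OF T f' that] rep_jsl_join_irr[OF S that])
  qed
  then show ?thesis
    by (intro dep_aut_hom_of_dfa_hom(1)[OF dep_aut_Airr[OF A] dep_aut_Airr[OF B] g])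
      (use Pirr_hom_subset in simp_all)
qed

text \<open>\<open>red A\<close> relates \<open>g\<close> to the meet-irreducible open sets not
  including \<open>G[{g}]\<close>, and these form the value of \<open>rep\<close> at
  \<open>G[{g}]\<close>. The second claim links the two families as the equivalence criterion
  asks.\<close>

lemma red_dep_aut_hom:
  assumes A: "dep_aut A"
  shows "red A \<in> dep_aut_hom A (on_obj Airr (on_obj Det A))"
    and "Open_hom (base A) (Pirr_obj (Open_obj (base A))) (red A) = rep (on_obj Det A)"
proof -
  note G = dep_autD(1)[OF A] and D = jsl_dfa_Det[OF A]
  have sub: "red A \<subseteq> src (base A) \<times> tgt (base (on_obj Airr (on_obj Det A)))"
    by (auto simp: red_def Let_def)
  have "rep (on_obj Det A) (hf_set (rel (base A) `` {g})) = hf_set (red A `` {g})"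
    if "g \<in> src (base A)" for g
  proof -
    have "red A `` {g} = {Y \<in> meet_irr (Open_obj (base A)).
        \<not> hf_set (rel (base A) `` {g}) \<sqsubseteq>\<^bsub>Open_obj (base A)\<^esub> Y}"
      using that by (auto simp: red_def Let_def open_in_opens[OF G] elts_open[OF G]
        dest: meet_irr_carrier)
    then show ?thesis
      by (simp add: rep_def open_in_opens[OF G])
  qed
  from dep_aut_hom_of_dfa_hom[OF A dep_aut_Airr[OF D] rep_dfa_hom[OF D] sub this]
  show "red A \<in> dep_aut_hom A (on_obj Airr (on_obj Det A))"
    and "Open_hom (base A) (Pirr_obj (Open_obj (base A))) (red A) = rep (on_obj Det A)"
    by simp_all
qed

theorem theorem3p2p6:
  shows "equivalence_of_categories
    (aut_Dep :: (('a, 'x hf) dep_aut, 'x hf rel) category)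
    (dfa_JSL :: (('a, 'x hf) jsl_dfa, 'x hf \<Rightarrow> 'x hf) category)
    Det Airr red rep"
proof -
  interpret category_embedding
    "aut_Dep :: (('a, 'x hf) dep_aut, 'x hf rel) category"
    "dfa_JSL :: (('a, 'x hf) jsl_dfa, 'x hf \<Rightarrow> 'x hf) category" Det
    by (rule category_embedding_Det)
  show ?thesis
  proof (rule equivalence_of_categoriesI)
    fix A B :: "('a, 'x hf) jsl_dfa" and f
    assume "A \<in> Obj dfa_JSL" "B \<in> Obj dfa_JSL" "f \<in> Hom dfa_JSL A B"
    then have A: "jsl_dfa A" and B: "jsl_dfa B" and f: "f \<in> jsl_dfa_hom A B"
      by simp_all
    show "on_hom Airr A B f \<in> Hom aut_Dep (on_obj Airr A) (on_obj Airr B)"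
      using Pirr_hom_dep_aut_hom[OF A B f] by simp
    \<comment> \<open>Composites are restricted to the carrier, so naturality of \<open>rep\<close>
      may be checked pointwise there.\<close>
    have "rep B (f s) = Open_hom (Pirr_obj (jsl A)) (Pirr_obj (jsl B)) (Pirr_hom (jsl A) (jsl B) f) (rep A s)"
      if "s \<in> carrier (jsl A)" for s
      using Pirr_hom(2)[of "jsl A" "jsl B" f, OF _ _ _ that] A B f
      by (simp add: jsl_dfa_def jsl_dfa_hom_iff rep_eq_rep_jsl)
    then show "Comp dfa_JSL A B (on_obj Det (on_obj Airr B)) f (rep B) =
        Comp dfa_JSL A (on_obj Det (on_obj Airr A)) (on_obj Det (on_obj Airr B)) (rep A)
          (on_hom Det (on_obj Airr A) (on_obj Airr B) (on_hom Airr A B f))"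
      by (simp add: compose_def cong: restrict_cong)
  qed (simp_all add: dep_aut_Airr rep_iso red_dep_aut_hom)
qed

end
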